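(* Let $(M,h)$ be a Hermitian manifold with background Riemannian metric $g=\mathrm{Re}\,h$. Suppose that the Riemann sectional curvature and the Chern sectional curvature coincide, i.e. $K_\nabla(u,v)=K_D(u,v)$ for all linearly independent tangent vectors $u,v\in TM$ at the same point. Then $h$ is a Kähler metric.
   Context: In local holomorphic coordinates $h=h_{\alpha\bar\beta}\,dz^\alpha d\bar z^\beta$; $g=\mathrm{Re}\,h$ is the associated Riemannian metric on the underlying real manifold and $J$ is the complex structure. $h$ is called Kähler if the form $\omega=\sqrt{-1}h_{\alpha\bar\beta}\,dz^\alpha\wedge d\bar z^\beta$ satisfies $d\omega=0$. Riemann sectional curvature: let $\nabla$ be the Levi-Civita connection of $g$ and $R(u,v,w,y)=g\big((\nabla_u\nabla_v-\nabla_v\nabla_u-\nabla_{[u,v]})w,y\big)$. For linearly independent $u,v$, $$K_\nabla(u,v)=\frac{R(u,v,v,u)}{g(u,u)g(v,v)-g(u,v)^2}.$$ Chern sectional curvature: the Chern connection is the unique connection on $T^{1,0}M$ compatible with $h$ and the holomorphic structure. Let $D$ be the connection on the real tangent bundle $TM$ obtained by transporting the Chern connection through the bundle isomorphism $TM\to T^{1,0}M$, $u\mapsto u_o=\frac12(u-\sqrt{-1}Ju)$, i.e. $(D_vu)_o=D_v(u_o)$ for real vector fields $u,v$. It is compatible with $g$ but in general has torsion. Its curvature is $(D^2u)(v,w)=D_vD_wu-D_wD_vu-D_{[v,w]}u$. For linearly independent $u,v$, $$K_D(u,v)=\frac{g\big((D^2u)(v,u),v\big)}{g(u,u)g(v,v)-g(u,v)^2}.$$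 *)

theory Defs
  imports "HOL-Analysis.Analysis" "HOL-Library.Function_Algebras"
begin

section \<open>Smooth and holomorphic maps between open sets\<close>

text \<open>\<open>Ck_on k S f\<close> is meant for open \<open>S\<close> in a finite-dimensional space, where having continuous
  directional derivatives in all directions is the same as being continuously differentiable.\<close>

primrec Ck_on ::
  "nat \<Rightarrow> 'a::real_normed_vector set \<Rightarrow> ('a \<Rightarrow> 'b::real_normed_vector) \<Rightarrow> bool" where
  "Ck_on 0 S f \<longleftrightarrow> continuous_on S f"
| "Ck_on (Suc k) S f \<longleftrightarrow>
     (\<forall>x\<in>S. f differentiable (at x)) \<and>
     (\<forall>v. Ck_on k S (\<lambda>x. frechet_derivative f (at x) v))"

definition smooth_on :: "'a::real_normed_vector set \<Rightarrow> ('a \<Rightarrow> 'b::real_normed_vector) \<Rightarrow> bool" where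
  "smooth_on S f \<longleftrightarrow> (\<forall>k. Ck_on k S f)"

text \<open>A map between open subsets of complex coordinate spaces is holomorphic if it is smooth and its
  differential is complex linear (the Cauchy--Riemann equations).\<close>

definition holomorphic_map_on :: "(complex^'m) set \<Rightarrow> (complex^'m \<Rightarrow> complex^'n) \<Rightarrow> bool" where
  "holomorphic_map_on S f \<longleftrightarrow>
     smooth_on S f \<and>
     (\<forall>x\<in>S. \<forall>a v. frechet_derivative f (at x) (a *s v) = a *s frechet_derivative f (at x) v)"


section \<open>Complex manifolds\<close>

text \<open>A chart is a domain together with a coordinate map; the values of the map outside the domain
  are irrelevant.\<close>

type_synonym ('a, 'n) chart = "'a set \<times> ('a \<Rightarrow> complex^'n)"

definition chart_inv :: "('a, 'n) chart \<Rightarrow> complex^'n \<Rightarrow> 'a" where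
  "chart_inv c = inv_into (fst c) (snd c)"

definition complex_atlas :: "'a topology \<Rightarrow> ('a, 'n::finite) chart set \<Rightarrow> bool" where
  "complex_atlas M A \<longleftrightarrow>
     (\<forall>c\<in>A. openin M (fst c) \<and> open (snd c ` fst c) \<and>
        homeomorphic_map (subtopology M (fst c)) (top_of_set (snd c ` fst c)) (snd c)) \<and>
     (\<Union>c\<in>A. fst c) = topspace M \<and>
     (\<forall>c\<in>A. \<forall>d\<in>A. holomorphic_map_on (snd c ` (fst c \<inter> fst d)) (snd d \<circ> chart_inv c))"

definition complex_manifold :: "'a topology \<Rightarrow> ('a, 'n::finite) chart set \<Rightarrow> bool" where
  "complex_manifold M A \<longleftrightarrow> Hausdorff_space M \<and> second_countable M \<and> complex_atlas M A"


section \<open>Tangent vectors and vector fields\<close>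

text \<open>A real tangent vector \<open>u\<close> at \<open>p\<close> is given by its components
  \<open>u c = (dz\<^sup>1(u), \<dots>, dz\<^sup>n(u))\<close> in the charts \<open>c\<close> around \<open>p\<close>, related by the differentials of the
  coordinate changes. Being real, \<open>u\<close> is determined by these complex numbers. Components in
  charts not containing \<open>p\<close> are set to 0, so that equality of tangent vectors is equality
  of functions. Sums and differences are pointwise.\<close>

type_synonym ('a, 'n) tvec = "('a, 'n) chart \<Rightarrow> complex^'n"

definition transition_deriv ::
  "('a, 'n::finite) chart \<Rightarrow> ('a, 'n) chart \<Rightarrow> 'a \<Rightarrow> complex^'n \<Rightarrow> complex^'n" where
  "transition_deriv c d p = frechet_derivative (snd d \<circ> chart_inv c) (at (snd c p))"

definition tangent_space :: "('a, 'n::finite) chart set \<Rightarrow> 'a \<Rightarrow> ('a, 'n) tvec set" where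
  "tangent_space A p =
     {u. (\<forall>c\<in>A. \<forall>d\<in>A. p \<in> fst c \<inter> fst d \<longrightarrow> u d = transition_deriv c d p (u c)) \<and>
         (\<forall>c. c \<notin> A \<or> p \<notin> fst c \<longrightarrow> u c = 0)}"

definition tscale :: "complex \<Rightarrow> ('a, 'n::finite) tvec \<Rightarrow> ('a, 'n) tvec" where
  "tscale a u = (\<lambda>c. a *s u c)"

text \<open>Since \<open>dz\<^sup>\<alpha>(Ju) = \<i> dz\<^sup>\<alpha>(u)\<close>, the complex structure multiplies all components by \<open>\<i>\<close>.\<close>

definition cJ :: "('a, 'n::finite) tvec \<Rightarrow> ('a, 'n) tvec" where
  "cJ u = tscale \<i> u"

definition lin_indep2 :: "('a, 'n::finite) tvec \<Rightarrow> ('a, 'n) tvec \<Rightarrow> bool" where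
  "lin_indep2 u v \<longleftrightarrow>
     (\<forall>a b :: real. tscale (of_real a) u + tscale (of_real b) v = 0 \<longrightarrow> a = 0 \<and> b = 0)"

definition smooth_fun ::
  "('a, 'n::finite) chart set \<Rightarrow> 'a set \<Rightarrow> ('a \<Rightarrow> 'b::real_normed_vector) \<Rightarrow> bool" where
  "smooth_fun A W f \<longleftrightarrow> (\<forall>c\<in>A. smooth_on (snd c ` (W \<inter> fst c)) (f \<circ> chart_inv c))"

text \<open>Smooth real vector fields over an open set \<open>W\<close>; values outside \<open>W\<close> are irrelevant.\<close>

definition vector_field ::
  "('a, 'n::finite) chart set \<Rightarrow> 'a set \<Rightarrow> ('a \<Rightarrow> ('a, 'n) tvec) \<Rightarrow> bool" where
  "vector_field A W X \<longleftrightarrow>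
     (\<forall>p\<in>W. X p \<in> tangent_space A p) \<and>
     (\<forall>c\<in>A. smooth_on (snd c ` (W \<inter> fst c)) (\<lambda>y. X (chart_inv c y) c))"

text \<open>The derivative of \<open>f\<close> at \<open>p\<close> along the tangent vector \<open>u\<close>; by the chain rule all charts give
  the same value.\<close>

definition deriv_along ::
  "('a, 'n::finite) chart set \<Rightarrow> 'a \<Rightarrow> ('a, 'n) tvec \<Rightarrow> ('a \<Rightarrow> 'b::real_normed_vector) \<Rightarrow> 'b" where
  "deriv_along A p u f =
     (THE r. \<forall>c\<in>A. p \<in> fst c \<longrightarrow> frechet_derivative (f \<circ> chart_inv c) (at (snd c p)) (u c) = r)"

definition lie_bracket ::
  "('a, 'n::finite) chart set \<Rightarrow> ('a \<Rightarrow> ('a, 'n) tvec) \<Rightarrow> ('a \<Rightarrow> ('a, 'n) tvec) \<Rightarrow> 'a \<Rightarrow> ('a, 'n) tvec" where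
  "lie_bracket A X Y p =
     (\<lambda>c. if c \<in> A \<and> p \<in> fst c then
            frechet_derivative (\<lambda>y. Y (chart_inv c y) c) (at (snd c p)) (X p c) -
            frechet_derivative (\<lambda>y. X (chart_inv c y) c) (at (snd c p)) (Y p c)
          else 0)"


section \<open>Complexified tangent vectors of type (1,0)\<close>

text \<open>A complexified tangent vector \<open>a + \<i> b\<close> is the pair \<open>(a, b)\<close> of its real and imaginary parts.\<close>

type_synonym ('a, 'n) cvec = "('a, 'n) tvec \<times> ('a, 'n) tvec"

definition cscale :: "complex \<Rightarrow> ('a, 'n::finite) cvec \<Rightarrow> ('a, 'n) cvec" where
  "cscale z s =
     (tscale (of_real (Re z)) (fst s) - tscale (of_real (Im z)) (snd s),
      tscale (of_real (Im z)) (fst s) + tscale (of_real (Re z)) (snd s))"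

text \<open>\<open>T\<^sup>1\<^sup>,\<^sup>0\<close> is the \<open>\<i>\<close>-eigenspace of the complex linear extension of \<open>J\<close>.\<close>

definition T10 :: "('a, 'n::finite) chart set \<Rightarrow> 'a \<Rightarrow> ('a, 'n) cvec set" where
  "T10 A p =
     {s. fst s \<in> tangent_space A p \<and> snd s \<in> tangent_space A p \<and>
         (cJ (fst s), cJ (snd s)) = cscale \<i> s}"

text \<open>The isomorphism \<open>u \<mapsto> u\<^sub>o = (u - \<i> J u) / 2\<close>.\<close>

definition to10 :: "('a, 'n::finite) tvec \<Rightarrow> ('a, 'n) cvec" where
  "to10 u = cscale (1/2) ((u, 0) - cscale \<i> (cJ u, 0))"

text \<open>The complex linear extension of \<open>(dz\<^sup>1, \<dots>, dz\<^sup>n)\<close>. For \<open>s\<close> of type (1,0) these are the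
  coefficients of \<open>s\<close> with respect to the frame \<open>\<partial>/\<partial>z\<^sup>\<alpha>\<close>.\<close>

definition dz :: "('a, 'n::finite) cvec \<Rightarrow> ('a, 'n) tvec" where
  "dz s = fst s + tscale \<i> (snd s)"

definition section10 ::
  "('a, 'n::finite) chart set \<Rightarrow> 'a set \<Rightarrow> ('a \<Rightarrow> ('a, 'n) cvec) \<Rightarrow> bool" where
  "section10 A W s \<longleftrightarrow>
     (\<forall>p\<in>W. s p \<in> T10 A p) \<and>
     vector_field A W (\<lambda>p. fst (s p)) \<and> vector_field A W (\<lambda>p. snd (s p))"


section \<open>Hermitian and Kaehler metrics\<close>

text \<open>A Hermitian metric is given by its coefficient matrices: \<open>h c p $ \<alpha> $ \<beta>\<close> is the coefficient
  of \<open>dz\<^sup>\<alpha> \<otimes> cnj (dz\<^sup>\<beta>)\<close> at the point \<open>p\<close> in the chart \<open>c\<close>.\<close>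

type_synonym ('a, 'n) metric_coeffs = "('a, 'n) chart \<Rightarrow> 'a \<Rightarrow> complex^'n^'n"

definition herm_form :: "complex^'n^'n::finite \<Rightarrow> complex^'n \<Rightarrow> complex^'n \<Rightarrow> complex" where
  "herm_form H \<zeta> \<eta> = (\<Sum>\<alpha>\<in>UNIV. \<Sum>\<beta>\<in>UNIV. H $ \<alpha> $ \<beta> * \<zeta> $ \<alpha> * cnj (\<eta> $ \<beta>))"

definition hermitian_metric ::
  "('a, 'n::finite) chart set \<Rightarrow> ('a, 'n) metric_coeffs \<Rightarrow> bool" where
  "hermitian_metric A h \<longleftrightarrow>
     (\<forall>c\<in>A. smooth_on (snd c ` fst c) (h c \<circ> chart_inv c)) \<and>
     (\<forall>c\<in>A. \<forall>p\<in>fst c.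
        (\<forall>\<alpha> \<beta>. h c p $ \<beta> $ \<alpha> = cnj (h c p $ \<alpha> $ \<beta>)) \<and>
        (\<forall>\<zeta>. \<zeta> \<noteq> 0 \<longrightarrow> 0 < Re (herm_form (h c p) \<zeta> \<zeta>))) \<and>
     (\<forall>c\<in>A. \<forall>d\<in>A. \<forall>p\<in>fst c \<inter> fst d. \<forall>u\<in>tangent_space A p. \<forall>v\<in>tangent_space A p.
        herm_form (h c p) (u c) (v c) = herm_form (h d p) (u d) (v d))"

text \<open>The chart-independent value of the form on two vectors given by their \<open>dz\<close>-components.\<close>

definition herm ::
  "('a, 'n::finite) chart set \<Rightarrow> ('a, 'n) metric_coeffs \<Rightarrow> 'a \<Rightarrow> ('a, 'n) tvec \<Rightarrow> ('a, 'n) tvec \<Rightarrow> complex" where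
  "herm A h p \<zeta> \<eta> =
     (THE r. \<forall>c\<in>A. p \<in> fst c \<longrightarrow> herm_form (h c p) (\<zeta> c) (\<eta> c) = r)"

definition herm10 ::
  "('a, 'n::finite) chart set \<Rightarrow> ('a, 'n) metric_coeffs \<Rightarrow> 'a \<Rightarrow> ('a, 'n) cvec \<Rightarrow> ('a, 'n) cvec \<Rightarrow> complex" where
  "herm10 A h p s t = herm A h p (dz s) (dz t)"

definition riem_g ::
  "('a, 'n::finite) chart set \<Rightarrow> ('a, 'n) metric_coeffs \<Rightarrow> 'a \<Rightarrow> ('a, 'n) tvec \<Rightarrow> ('a, 'n) tvec \<Rightarrow> real" where
  "riem_g A h p u v = Re (herm A h p u v)"

text \<open>\<open>\<omega> = \<i> h\<^sub>\<alpha>\<^sub>\<beta> dz\<^sup>\<alpha> \<and> cnj (dz\<^sup>\<beta>)\<close> in a chart, as a 2-form on the coordinate domain.\<close>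

definition fundamental_form ::
  "('a, 'n::finite) metric_coeffs \<Rightarrow> ('a, 'n) chart \<Rightarrow> complex^'n \<Rightarrow> complex^'n \<Rightarrow> complex^'n \<Rightarrow> complex" where
  "fundamental_form h c y a b =
     \<i> * (\<Sum>\<alpha>\<in>UNIV. \<Sum>\<beta>\<in>UNIV. h c (chart_inv c y) $ \<alpha> $ \<beta> *
            (a $ \<alpha> * cnj (b $ \<beta>) - b $ \<alpha> * cnj (a $ \<beta>)))"

text \<open>The exterior derivative of a 2-form on an open set, evaluated on constant vector fields.\<close>

definition ext_deriv2 ::
  "('v::real_normed_vector \<Rightarrow> 'v \<Rightarrow> 'v \<Rightarrow> complex) \<Rightarrow> 'v \<Rightarrow> 'v \<Rightarrow> 'v \<Rightarrow> 'v \<Rightarrow> complex" where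
  "ext_deriv2 w y a b e =
     frechet_derivative (\<lambda>x. w x b e) (at y) a -
     frechet_derivative (\<lambda>x. w x a e) (at y) b +
     frechet_derivative (\<lambda>x. w x a b) (at y) e"

definition kaehler_metric ::
  "('a, 'n::finite) chart set \<Rightarrow> ('a, 'n) metric_coeffs \<Rightarrow> bool" where
  "kaehler_metric A h \<longleftrightarrow>
     hermitian_metric A h \<and>
     (\<forall>c\<in>A. \<forall>y\<in>snd c ` fst c. \<forall>a b e. ext_deriv2 (fundamental_form h c) y a b e = 0)"


section \<open>Connections\<close>

text \<open>Connections act on fields defined near a point: \<open>nabla X Y\<close> only has a meaning on open
  sets where both arguments are smooth, and the axioms are required over every open set.
  (On a manifold this is the same as an operator on global fields.)\<close>

definition affine_connection ::
  "'a topology \<Rightarrow> ('a, 'n::finite) chart set \<Rightarrow>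
   (('a \<Rightarrow> ('a, 'n) tvec) \<Rightarrow> ('a \<Rightarrow> ('a, 'n) tvec) \<Rightarrow> 'a \<Rightarrow> ('a, 'n) tvec) \<Rightarrow> bool" where
  "affine_connection M A nabla \<longleftrightarrow>
     (\<forall>W. openin M W \<longrightarrow>
        (\<forall>X Y. vector_field A W X \<and> vector_field A W Y \<longrightarrow> vector_field A W (nabla X Y)) \<and>
        (\<forall>X X' Y. vector_field A W X \<and> vector_field A W X' \<and> vector_field A W Y \<longrightarrow>
           (\<forall>p\<in>W. nabla (X + X') Y p = nabla X Y p + nabla X' Y p)) \<and>
        (\<forall>f :: 'a \<Rightarrow> real. \<forall>X Y. smooth_fun A W f \<and> vector_field A W X \<and> vector_field A W Y \<longrightarrow>
           (\<forall>p\<in>W. nabla (\<lambda>q. tscale (of_real (f q)) (X q)) Y p = tscale (of_real (f p)) (nabla X Y p))) \<and>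
        (\<forall>X Y Y'. vector_field A W X \<and> vector_field A W Y \<and> vector_field A W Y' \<longrightarrow>
           (\<forall>p\<in>W. nabla X (Y + Y') p = nabla X Y p + nabla X Y' p)) \<and>
        (\<forall>f :: 'a \<Rightarrow> real. \<forall>X Y. smooth_fun A W f \<and> vector_field A W X \<and> vector_field A W Y \<longrightarrow>
           (\<forall>p\<in>W. nabla X (\<lambda>q. tscale (of_real (f q)) (Y q)) p =
              tscale (of_real (deriv_along A p (X p) f)) (Y p) + tscale (of_real (f p)) (nabla X Y p))))"

definition levi_civita ::
  "'a topology \<Rightarrow> ('a, 'n::finite) chart set \<Rightarrow> ('a, 'n) metric_coeffs \<Rightarrow>
   (('a \<Rightarrow> ('a, 'n) tvec) \<Rightarrow> ('a \<Rightarrow> ('a, 'n) tvec) \<Rightarrow> 'a \<Rightarrow> ('a, 'n) tvec) \<Rightarrow> bool" where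
  "levi_civita M A h nabla \<longleftrightarrow>
     affine_connection M A nabla \<and>
     (\<forall>W. openin M W \<longrightarrow>
        (\<forall>X Y. vector_field A W X \<and> vector_field A W Y \<longrightarrow>
           (\<forall>p\<in>W. nabla X Y p - nabla Y X p = lie_bracket A X Y p)) \<and>
        (\<forall>X Y Z. vector_field A W X \<and> vector_field A W Y \<and> vector_field A W Z \<longrightarrow>
           (\<forall>p\<in>W. deriv_along A p (X p) (\<lambda>q. riem_g A h q (Y q) (Z q)) =
              riem_g A h p (nabla X Y p) (Z p) + riem_g A h p (Y p) (nabla X Z p))))"

definition connection10 ::
  "'a topology \<Rightarrow> ('a, 'n::finite) chart set \<Rightarrow>
   (('a \<Rightarrow> ('a, 'n) tvec) \<Rightarrow> ('a \<Rightarrow> ('a, 'n) cvec) \<Rightarrow> 'a \<Rightarrow> ('a, 'n) cvec) \<Rightarrow> bool" where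
  "connection10 M A D \<longleftrightarrow>
     (\<forall>W. openin M W \<longrightarrow>
        (\<forall>X s. vector_field A W X \<and> section10 A W s \<longrightarrow> section10 A W (D X s)) \<and>
        (\<forall>X X' s. vector_field A W X \<and> vector_field A W X' \<and> section10 A W s \<longrightarrow>
           (\<forall>p\<in>W. D (X + X') s p = D X s p + D X' s p)) \<and>
        (\<forall>f :: 'a \<Rightarrow> real. \<forall>X s. smooth_fun A W f \<and> vector_field A W X \<and> section10 A W s \<longrightarrow>
           (\<forall>p\<in>W. D (\<lambda>q. tscale (of_real (f q)) (X q)) s p = cscale (of_real (f p)) (D X s p))) \<and>
        (\<forall>X s t. vector_field A W X \<and> section10 A W s \<and> section10 A W t \<longrightarrow>
           (\<forall>p\<in>W. D X (s + t) p = D X s p + D X t p)) \<and>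
        (\<forall>f :: 'a \<Rightarrow> complex. \<forall>X s. smooth_fun A W f \<and> vector_field A W X \<and> section10 A W s \<longrightarrow>
           (\<forall>p\<in>W. D X (\<lambda>q. cscale (f q) (s q)) p =
              cscale (deriv_along A p (X p) f) (s p) + cscale (f p) (D X s p))))"

text \<open>Compatibility with the holomorphic structure means \<open>D\<^sup>0\<^sup>,\<^sup>1 = \<partial>\<close>-bar: along the (0,1)-vector
  \<open>X + \<i> J X\<close>, the connection differentiates the coefficients with respect to the holomorphic frame
  \<open>\<partial>/\<partial>z\<^sup>\<alpha>\<close> of each chart.\<close>

definition chern_connection ::
  "'a topology \<Rightarrow> ('a, 'n::finite) chart set \<Rightarrow> ('a, 'n) metric_coeffs \<Rightarrow>
   (('a \<Rightarrow> ('a, 'n) tvec) \<Rightarrow> ('a \<Rightarrow> ('a, 'n) cvec) \<Rightarrow> 'a \<Rightarrow> ('a, 'n) cvec) \<Rightarrow> bool" where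
  "chern_connection M A h D \<longleftrightarrow>
     connection10 M A D \<and>
     (\<forall>W. openin M W \<longrightarrow>
        (\<forall>X s t. vector_field A W X \<and> section10 A W s \<and> section10 A W t \<longrightarrow>
           (\<forall>p\<in>W. deriv_along A p (X p) (\<lambda>q. herm10 A h q (s q) (t q)) =
              herm10 A h p (D X s p) (t p) + herm10 A h p (s p) (D X t p))) \<and>
        (\<forall>X s. vector_field A W X \<and> section10 A W s \<longrightarrow>
           (\<forall>c\<in>A. \<forall>p\<in>W \<inter> fst c.
              dz (D X s p + cscale \<i> (D (\<lambda>q. cJ (X q)) s p)) c =
              frechet_derivative (\<lambda>y. dz (s (chart_inv c y)) c) (at (snd c p)) (X p c) +
              \<i> *s frechet_derivative (\<lambda>y. dz (s (chart_inv c y)) c) (at (snd c p)) (cJ (X p) c))))"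

text \<open>The connection on the real tangent bundle with \<open>(D\<^sub>v u)\<^sub>o = D\<^sub>v (u\<^sub>o)\<close>.\<close>

definition transport_to_real ::
  "('a, 'n::finite) chart set \<Rightarrow>
   (('a \<Rightarrow> ('a, 'n) tvec) \<Rightarrow> ('a \<Rightarrow> ('a, 'n) cvec) \<Rightarrow> 'a \<Rightarrow> ('a, 'n) cvec) \<Rightarrow>
   ('a \<Rightarrow> ('a, 'n) tvec) \<Rightarrow> ('a \<Rightarrow> ('a, 'n) tvec) \<Rightarrow> 'a \<Rightarrow> ('a, 'n) tvec" where
  "transport_to_real A D X Y p =
     (THE w. w \<in> tangent_space A p \<and> to10 w = D X (\<lambda>q. to10 (Y q)) p)"


section \<open>Sectional curvatures\<close>

definition curvature_op ::
  "('a, 'n::finite) chart set \<Rightarrow>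
   (('a \<Rightarrow> ('a, 'n) tvec) \<Rightarrow> ('a \<Rightarrow> ('a, 'n) tvec) \<Rightarrow> 'a \<Rightarrow> ('a, 'n) tvec) \<Rightarrow>
   ('a \<Rightarrow> ('a, 'n) tvec) \<Rightarrow> ('a \<Rightarrow> ('a, 'n) tvec) \<Rightarrow> ('a \<Rightarrow> ('a, 'n) tvec) \<Rightarrow> 'a \<Rightarrow> ('a, 'n) tvec" where
  "curvature_op A nabla X Y Z =
     nabla X (nabla Y Z) - nabla Y (nabla X Z) - nabla (lie_bracket A X Y) Z"

definition extends_vector ::
  "'a topology \<Rightarrow> ('a, 'n::finite) chart set \<Rightarrow> 'a \<Rightarrow> ('a, 'n) tvec \<Rightarrow> ('a \<Rightarrow> ('a, 'n) tvec) \<Rightarrow> bool" where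
  "extends_vector M A p u X \<longleftrightarrow> (\<exists>W. openin M W \<and> p \<in> W \<and> vector_field A W X) \<and> X p = u"

text \<open>The curvature tensor at \<open>p\<close>: the value of \<open>curvature_op\<close> on arbitrary local extensions of the
  three tangent vectors, on which it does not depend.\<close>

definition curvature_at ::
  "'a topology \<Rightarrow> ('a, 'n::finite) chart set \<Rightarrow>
   (('a \<Rightarrow> ('a, 'n) tvec) \<Rightarrow> ('a \<Rightarrow> ('a, 'n) tvec) \<Rightarrow> 'a \<Rightarrow> ('a, 'n) tvec) \<Rightarrow>
   'a \<Rightarrow> ('a, 'n) tvec \<Rightarrow> ('a, 'n) tvec \<Rightarrow> ('a, 'n) tvec \<Rightarrow> ('a, 'n) tvec" where
  "curvature_at M A nabla p u v w =
     (THE r. \<forall>X Y Z. extends_vector M A p u X \<and> extends_vector M A p v Y \<and> extends_vector M A p w Z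
        \<longrightarrow> curvature_op A nabla X Y Z p = r)"

definition area2 ::
  "('a, 'n::finite) chart set \<Rightarrow> ('a, 'n) metric_coeffs \<Rightarrow> 'a \<Rightarrow> ('a, 'n) tvec \<Rightarrow> ('a, 'n) tvec \<Rightarrow> real" where
  "area2 A h p u v = riem_g A h p u u * riem_g A h p v v - (riem_g A h p u v)\<^sup>2"

definition riemann_sectional ::
  "'a topology \<Rightarrow> ('a, 'n::finite) chart set \<Rightarrow> ('a, 'n) metric_coeffs \<Rightarrow>
   (('a \<Rightarrow> ('a, 'n) tvec) \<Rightarrow> ('a \<Rightarrow> ('a, 'n) tvec) \<Rightarrow> 'a \<Rightarrow> ('a, 'n) tvec) \<Rightarrow>
   'a \<Rightarrow> ('a, 'n) tvec \<Rightarrow> ('a, 'n) tvec \<Rightarrow> real" where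
  "riemann_sectional M A h nabla p u v =
     riem_g A h p (curvature_at M A nabla p u v v) u / area2 A h p u v"

text \<open>With \<open>(D\<^sup>2 u)(v, w) = D\<^sub>v D\<^sub>w u - D\<^sub>w D\<^sub>v u - D\<^bsub>[v,w]\<^esub> u\<close>, the numerator is \<open>g((D\<^sup>2 u)(v, u), v)\<close>.\<close>

definition chern_sectional ::
  "'a topology \<Rightarrow> ('a, 'n::finite) chart set \<Rightarrow> ('a, 'n) metric_coeffs \<Rightarrow>
   (('a \<Rightarrow> ('a, 'n) tvec) \<Rightarrow> ('a \<Rightarrow> ('a, 'n) cvec) \<Rightarrow> 'a \<Rightarrow> ('a, 'n) cvec) \<Rightarrow>
   'a \<Rightarrow> ('a, 'n) tvec \<Rightarrow> ('a, 'n) tvec \<Rightarrow> real" where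
  "chern_sectional M A h D p u v =
     riem_g A h p (curvature_at M A (transport_to_real A D) p v u u) v / area2 A h p u v"

end

theory Submission
  imports Defs
begin

text \<open>Let \<open>\<theta>\<close> be the contorsion, that is the Chern connection minus the Levi-Civita connection, and
  \<open>T\<close> the torsion of the Chern connection. Both connections are metric, so \<open>\<theta>(a, \<cdot>)\<close> is
  skew-symmetric, and \<open>T\<close> is complex bilinear. It follows that \<open>\<theta>(u, Ju) = \<theta>(Ju, u) = 0\<close>,
  \<open>\<theta>(Ju, Ju) = \<theta>(u, u)\<close> and \<open>g(\<theta>(u, u), w) = g(T(w, u), u)\<close>. The two curvature numerators on the
  holomorphic plane of \<open>u\<close> and \<open>Ju\<close> then differ by exactly \<open>\<bar>\<theta>(u, u)\<bar>\<^sup>2\<close>. If they agree on all these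
  planes, then \<open>g(T(w, u), u) = 0\<close> for all \<open>u\<close> and \<open>w\<close>, which together with complex bilinearity
  forces \<open>T = 0\<close>, and a Hermitian metric whose Chern connection is torsion-free is Kaehler.\<close>

section \<open>Calculus of \<open>Ck_on\<close> and \<open>smooth_on\<close>\<close>

text \<open>The difference of the curvatures of two connections in general contains derivatives of
  \<theta>, on which pointwise algebra has no hold. Pairing with Ju on the plane of u and Ju removes
  this obstacle. The map \<theta>(Ju, u) vanishes identically, so its derivative drops out. Moreover
  \<theta>(u, u) is orthogonal to Ju at every point, because T(Ju, u) = J T(u, u) = 0;
  differentiating this relation trades the derivative of \<theta>(u, u) for terms without
  derivatives, and \<theta>(Ju, Ju) = \<theta>(u, u) turns one of them into the square. These are
  identities between functions on an open set, with u constant in coordinates. Hence both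
  connections, given only as operators on local fields, are first replaced by their Christoffel
  symbols in a chart. The Levi-Civita symbols are only real bilinear there; the Chern symbols are
  complex bilinear, in the second argument because the transported connection commutes with J, in
  the first because the coordinate frame is holomorphic.\<close>

lemma frechet_derivative_eqI: "(f has_derivative f') (at x) \<Longrightarrow> frechet_derivative f (at x) = f'"
  by (rule frechet_derivative_at[symmetric])

lemma differentiable_has_frechet:
  "f differentiable (at x) \<Longrightarrow> (f has_derivative frechet_derivative f (at x)) (at x)"
  by (simp add: frechet_derivative_works)

lemma differentiable_transform_open:
  assumes "f differentiable (at x)" "open S" "x \<in> S" "\<And>y. y \<in> S \<Longrightarrow> f y = g y"
  shows "g differentiable (at x)"
  using assms has_derivative_transform_within_open unfolding differentiable_def by metis

lemma Ck_on_cong_imp: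
  assumes "open S" "\<And>x. x \<in> S \<Longrightarrow> f x = g x" "Ck_on k S f"
  shows "Ck_on k S g"
  using assms(2,3)
proof (induction k arbitrary: f g)
  case 0
  then show ?case using continuous_on_cong[of S S f g] by auto
next
  case (Suc k)
  have d: "frechet_derivative f (at x) = frechet_derivative g (at x)" if "x \<in> S" for x
    using frechet_derivative_transform_within_open[of f x S g] that assms(1) Suc.prems by auto
  have "g differentiable (at x)" if "x \<in> S" for x
    using differentiable_transform_open[of f x S g] that assms(1) Suc.prems by auto
  moreover have "Ck_on k S (\<lambda>x. frechet_derivative g (at x) v)" for v
    by (rule Suc.IH[of "\<lambda>x. frechet_derivative f (at x) v"]) (use d Suc.prems in auto)
  ultimately show ?case by simp
qed

lemma Ck_on_cong:
  assumes "open S" "\<And>x. x \<in> S \<Longrightarrow> f x = g x"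
  shows "Ck_on k S f \<longleftrightarrow> Ck_on k S g"
  using Ck_on_cong_imp[of S f g k] Ck_on_cong_imp[of S g f k] assms by auto

lemma Ck_on_SucD: "Ck_on (Suc k) S f \<Longrightarrow> Ck_on k S f"
proof (induction k arbitrary: f)
  case 0
  then have "continuous (at x) f" if "x \<in> S" for x
    using that differentiable_imp_continuous_within by auto
  then show ?case by (simp add: continuous_at_imp_continuous_on)
next
  case (Suc k)
  then show ?case by (simp only: Ck_on.simps) blast
qed

lemma Ck_on_subset: "Ck_on k T f \<Longrightarrow> S \<subseteq> T \<Longrightarrow> Ck_on k S f"
  by (induction k arbitrary: f) (auto intro: continuous_on_subset)

lemma Ck_on_const: "Ck_on k S (\<lambda>x. c)"
  by (induction k arbitrary: c) auto

lemma Ck_on_linear: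
  assumes "open S" "bounded_linear L" "Ck_on k S f"
  shows "Ck_on k S (\<lambda>x. L (f x))"
  using assms(3)
proof (induction k arbitrary: f)
  case 0
  then show ?case using bounded_linear.continuous_on[OF assms(2)] by auto
next
  case (Suc k)
  have d: "((\<lambda>x. L (f x)) has_derivative (\<lambda>v. L (frechet_derivative f (at x) v))) (at x)" if "x \<in> S" for x
    by (rule bounded_linear.has_derivative[OF assms(2)], rule differentiable_has_frechet)
      (use Suc.prems that in auto)
  have "Ck_on k S (\<lambda>x. frechet_derivative (\<lambda>x. L (f x)) (at x) v)" for v
    by (rule Ck_on_cong_imp[OF assms(1) _ Suc.IH[of "\<lambda>x. frechet_derivative f (at x) v"]])
      (use Suc.prems in \<open>auto simp: frechet_derivative_eqI[OF d]\<close>)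
  then show ?case using d by (auto simp: differentiable_def)
qed

lemma Ck_on_add:
  assumes "open S" "Ck_on k S f" "Ck_on k S g"
  shows "Ck_on k S (\<lambda>x. f x + g x)"
  using assms(2,3)
proof (induction k arbitrary: f g)
  case 0
  then show ?case by (auto intro: continuous_intros)
next
  case (Suc k)
  have d: "((\<lambda>x. f x + g x) has_derivative
      (\<lambda>v. frechet_derivative f (at x) v + frechet_derivative g (at x) v)) (at x)" if "x \<in> S" for x
    by (intro has_derivative_add differentiable_has_frechet) (use Suc.prems that in auto)
  have "Ck_on k S (\<lambda>x. frechet_derivative (\<lambda>x. f x + g x) (at x) v)" for v
    by (rule Ck_on_cong_imp[OF assms(1) _ Suc.IH[of "\<lambda>x. frechet_derivative f (at x) v"
          "\<lambda>x. frechet_derivative g (at x) v"]])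
      (use Suc.prems in \<open>auto simp: frechet_derivative_eqI[OF d]\<close>)
  then show ?case using d by (auto simp: differentiable_def)
qed

lemma Ck_on_sum:
  assumes "open S" "\<And>i. i \<in> I \<Longrightarrow> Ck_on k S (f i)"
  shows "Ck_on k S (\<lambda>x. \<Sum>i\<in>I. f i x)"
  using assms(2) by (induction I rule: infinite_finite_induct) (auto intro: Ck_on_const Ck_on_add assms(1))

lemma Ck_on_bilinear:
  assumes "open S" "bounded_bilinear B" "Ck_on k S f" "Ck_on k S g"
  shows "Ck_on k S (\<lambda>x. B (f x) (g x))"
  using assms(3,4)
proof (induction k arbitrary: f g)
  case 0
  then show ?case using bounded_bilinear.continuous_on[OF assms(2)] by auto
next
  case (Suc k)
  have d: "((\<lambda>x. B (f x) (g x)) has_derivative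
      (\<lambda>v. B (f x) (frechet_derivative g (at x) v) + B (frechet_derivative f (at x) v) (g x))) (at x)"
    if "x \<in> S" for x
    by (intro bounded_bilinear.FDERIV[OF assms(2)] differentiable_has_frechet) (use Suc.prems that in auto)
  have "Ck_on k S (\<lambda>x. frechet_derivative (\<lambda>x. B (f x) (g x)) (at x) v)" for v
  proof (rule Ck_on_cong_imp[OF assms(1)])
    show "Ck_on k S (\<lambda>x. B (f x) (frechet_derivative g (at x) v) + B (frechet_derivative f (at x) v) (g x))"
      using Suc.prems by (intro Ck_on_add assms(1) Suc.IH) (auto intro: Ck_on_SucD simp del: Ck_on.simps, auto)
  qed (simp add: frechet_derivative_eqI[OF d])
  then show ?case using d by (auto simp: differentiable_def)
qed

lemma linear_Basis_expansion:
  fixes F :: "'a::euclidean_space \<Rightarrow> 'b::real_vector"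
  assumes "linear F"
  shows "F v = (\<Sum>b\<in>Basis. (v \<bullet> b) *\<^sub>R F b)"
proof -
  have "F v = F (\<Sum>b\<in>Basis. (v \<bullet> b) *\<^sub>R b)" by (simp add: euclidean_representation)
  then show ?thesis by (simp add: linear_sum[OF assms] linear_scale[OF assms])
qed

text \<open>Regularity of a family of linear maps is asked for vector by vector, the form in which
  \<open>frechet_derivative\<close> and the Christoffel symbols provide it. A finite basis turns
  evaluation at a moving vector into a finite sum of products.\<close>

lemma Ck_on_apply:
  fixes F :: "'c::real_normed_vector \<Rightarrow> 'a::euclidean_space \<Rightarrow> 'b::real_normed_vector"
  assumes "open S" "\<And>x. x \<in> S \<Longrightarrow> linear (F x)" "\<And>v. Ck_on k S (\<lambda>x. F x v)" "Ck_on k S w"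
  shows "Ck_on k S (\<lambda>x. F x (w x))"
proof (rule Ck_on_cong_imp[OF assms(1)])
  show "Ck_on k S (\<lambda>x. \<Sum>b\<in>Basis. (w x \<bullet> b) *\<^sub>R F x b)"
    by (intro Ck_on_sum Ck_on_bilinear[OF _ bounded_bilinear_scaleR] assms Ck_on_linear[OF assms(1) bounded_linear_inner_left])
qed (use assms(2) linear_Basis_expansion in metis)

text \<open>By the chain rule the derivative is the family of differentials of \<open>g\<close>
  along \<open>f\<close>, evaluated at a moving vector, which is the situation of
  \<open>Ck_on_apply\<close>. The induction therefore generalizes over \<open>g\<close> and keeps
  \<open>f\<close> fixed.\<close>

lemma Ck_on_compose:
  fixes f :: "'c::real_normed_vector \<Rightarrow> 'a::euclidean_space" and g :: "'a \<Rightarrow> 'b::real_normed_vector"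
  assumes "open S" "f ` S \<subseteq> T" "Ck_on k S f" "Ck_on k T g"
  shows "Ck_on k S (g \<circ> f)"
  using assms(3,4)
proof (induction k arbitrary: g)
  case 0
  then show ?case
    by (auto intro: continuous_on_compose continuous_on_subset[OF _ assms(2)] simp del: o_apply simp: o_def[symmetric])
next
  case (Suc k)
  have d: "(g \<circ> f has_derivative
      (\<lambda>v. frechet_derivative g (at (f x)) (frechet_derivative f (at x) v))) (at x)"
    if "x \<in> S" for x
    using diff_chain_at[OF differentiable_has_frechet differentiable_has_frechet, of f x g]
      Suc.prems that assms(2)
    by (auto simp: o_def image_subset_iff)
  have "Ck_on k S (\<lambda>x. frechet_derivative (g \<circ> f) (at x) v)" for v
  proof (rule Ck_on_cong_imp[OF assms(1)])
    have "Ck_on k S ((\<lambda>y. frechet_derivative g (at y) v) \<circ> f)" for v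
      using Suc.prems by (intro Suc.IH) (auto intro: Ck_on_SucD simp del: Ck_on.simps, auto)
    then have c: "Ck_on k S (\<lambda>x. frechet_derivative g (at (f x)) v)" for v
      by (simp add: o_def)
    have "linear (frechet_derivative g (at (f x)))" if "x \<in> S" for x
      using Suc.prems(2) assms(2) that by (intro linear_frechet_derivative) auto
    moreover note c
    moreover have "Ck_on k S (\<lambda>x. frechet_derivative f (at x) v)"
      using Suc.prems(1) by simp
    ultimately show "Ck_on k S (\<lambda>x. frechet_derivative g (at (f x)) (frechet_derivative f (at x) v))"
      by (rule Ck_on_apply[OF assms(1), where F = "\<lambda>x. frechet_derivative g (at (f x))"])
  qed (simp add: frechet_derivative_eqI[OF d])
  then show ?case using d unfolding Ck_on.simps differentiable_def by blast
qed

lemma smooth_on_cong: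
  assumes "open S" "\<And>x. x \<in> S \<Longrightarrow> f x = g x"
  shows "smooth_on S f \<longleftrightarrow> smooth_on S g"
  using Ck_on_cong[OF assms] by (simp add: smooth_on_def)

lemma smooth_on_subset: "smooth_on T f \<Longrightarrow> S \<subseteq> T \<Longrightarrow> smooth_on S f"
  by (auto simp: smooth_on_def intro: Ck_on_subset)

lemma smooth_on_const: "smooth_on S (\<lambda>x. c)"
  by (simp add: smooth_on_def Ck_on_const)

lemma smooth_on_linear:
  "open S \<Longrightarrow> bounded_linear L \<Longrightarrow> smooth_on S f \<Longrightarrow> smooth_on S (\<lambda>x. L (f x))"
  by (simp add: smooth_on_def Ck_on_linear)

lemma smooth_on_add:
  "open S \<Longrightarrow> smooth_on S f \<Longrightarrow> smooth_on S g \<Longrightarrow> smooth_on S (\<lambda>x. f x + g x)"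
  by (simp add: smooth_on_def Ck_on_add)

lemma smooth_on_bilinear:
  "open S \<Longrightarrow> bounded_bilinear B \<Longrightarrow> smooth_on S f \<Longrightarrow> smooth_on S g \<Longrightarrow> smooth_on S (\<lambda>x. B (f x) (g x))"
  by (simp add: smooth_on_def Ck_on_bilinear)

lemma smooth_on_apply:
  fixes F :: "'c::real_normed_vector \<Rightarrow> 'a::euclidean_space \<Rightarrow> 'b::real_normed_vector"
  assumes "open S" "\<And>x. x \<in> S \<Longrightarrow> linear (F x)" "\<And>v. smooth_on S (\<lambda>x. F x v)" "smooth_on S w"
  shows "smooth_on S (\<lambda>x. F x (w x))"
  using assms by (simp add: smooth_on_def Ck_on_apply)

lemma smooth_on_compose:
  fixes f :: "'c::real_normed_vector \<Rightarrow> 'a::euclidean_space" and g :: "'a \<Rightarrow> 'b::real_normed_vector"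
  assumes "open S" "f ` S \<subseteq> T" "smooth_on S f" "smooth_on T g"
  shows "smooth_on S (g \<circ> f)"
  using assms by (simp add: smooth_on_def Ck_on_compose)

lemma smooth_on_differentiable: "smooth_on S f \<Longrightarrow> x \<in> S \<Longrightarrow> f differentiable (at x)"
  unfolding smooth_on_def by (metis Ck_on.simps(2))

lemma smooth_on_frechet: "smooth_on S f \<Longrightarrow> smooth_on S (\<lambda>x. frechet_derivative f (at x) v)"
  unfolding smooth_on_def by (metis Ck_on.simps(2))

text \<open>The product rule that goes with \<open>Ck_on_apply\<close>: \<open>F\<close> is
  differentiated only on fixed vectors, so in the first term its argument is frozen at
  \<open>w y\<close>.\<close>

lemma has_derivative_apply:
  fixes F :: "'c::real_normed_vector \<Rightarrow> 'a::euclidean_space \<Rightarrow> 'b::real_normed_vector"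
  assumes "open S" "y \<in> S" "\<And>x. x \<in> S \<Longrightarrow> linear (F x)"
    and "\<And>v. (\<lambda>x. F x v) differentiable (at y)" "(w has_derivative w') (at y)"
  shows "((\<lambda>x. F x (w x)) has_derivative
           (\<lambda>v. frechet_derivative (\<lambda>x. F x (w y)) (at y) v + F y (w' v))) (at y)"
proof -
  let ?D = "\<lambda>b. frechet_derivative (\<lambda>x. F x b) (at y)"
  have F: "((\<lambda>x. F x b) has_derivative ?D b) (at y)" for b
    using assms(4) by (rule differentiable_has_frechet)
  have rep: "((\<lambda>x. F x (u x)) has_derivative
      (\<lambda>v. \<Sum>b\<in>Basis. (u y \<bullet> b) *\<^sub>R ?D b v + (u' v \<bullet> b) *\<^sub>R F y b)) (at y)"
    if u: "(u has_derivative u') (at y)" for u u'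
  proof (rule has_derivative_transform_within_open[OF _ assms(1,2)])
    show "((\<lambda>x. \<Sum>b\<in>Basis. (u x \<bullet> b) *\<^sub>R F x b) has_derivative
      (\<lambda>v. \<Sum>b\<in>Basis. (u y \<bullet> b) *\<^sub>R ?D b v + (u' v \<bullet> b) *\<^sub>R F y b)) (at y)"
      by (intro derivative_intros F u)
  qed (use assms(3) linear_Basis_expansion in metis)
  have c: "?D (w y) = (\<lambda>v. \<Sum>b\<in>Basis. (w y \<bullet> b) *\<^sub>R ?D b v)"
    using rep[of "\<lambda>x. w y" "\<lambda>v. 0"] by (simp add: frechet_derivative_eqI)
  show ?thesis
    using rep[OF assms(5)]
    by (simp add: c linear_Basis_expansion[OF assms(3)[OF assms(2)], of "w' _"] sum.distrib)
qed

section \<open>Symmetry of second derivatives\<close>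

lemma has_real_derivative_along_line:
  fixes f :: "'a::real_normed_vector \<Rightarrow> real"
  assumes "f differentiable (at (x + s *\<^sub>R v))"
  shows "((\<lambda>s. f (x + s *\<^sub>R v)) has_real_derivative frechet_derivative f (at (x + s *\<^sub>R v)) v) (at s)"
proof -
  have l: "linear (frechet_derivative f (at (x + s *\<^sub>R v)))"
    using assms by (rule linear_frechet_derivative)
  have "((\<lambda>s. x + s *\<^sub>R v) has_derivative (\<lambda>r. r *\<^sub>R v)) (at s)"
    by (auto intro!: derivative_eq_intros)
  from diff_chain_at[OF this differentiable_has_frechet[OF assms]]
  have "((\<lambda>s. f (x + s *\<^sub>R v)) has_derivative (\<lambda>r. frechet_derivative f (at (x + s *\<^sub>R v)) (r *\<^sub>R v))) (at s)"
    by (simp add: o_def)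
  moreover have "(\<lambda>r. frechet_derivative f (at (x + s *\<^sub>R v)) (r *\<^sub>R v)) = (*) (frechet_derivative f (at (x + s *\<^sub>R v)) v)"
    by (simp add: linear_scale[OF l] mult.commute fun_eq_iff)
  ultimately show ?thesis
    by (simp add: has_field_derivative_def)
qed

text \<open>The second difference is symmetric in \<open>v\<close> and \<open>w\<close>, the
  iterated derivative is not; using the lemma in both orders equates the two mixed derivatives at
  points close to \<open>x\<close>. The mean value theorem is applied along \<open>v\<close> to the
  difference of \<open>f\<close> on two parallel segments, then along \<open>w\<close> to the
  derivative in direction \<open>v\<close>.\<close>

lemma second_difference_mvt:
  fixes f :: "'a::real_normed_vector \<Rightarrow> real"
  assumes S: "\<And>a b. 0 \<le> a \<Longrightarrow> a \<le> s \<Longrightarrow> 0 \<le> b \<Longrightarrow> b \<le> s \<Longrightarrow> x + a *\<^sub>R v + b *\<^sub>R w \<in> S"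
    and s: "0 < s" and f: "Ck_on 2 S f"
  obtains a b where "0 < a" "a < s" "0 < b" "b < s"
    "f (x + s *\<^sub>R v + s *\<^sub>R w) - f (x + s *\<^sub>R v) - f (x + s *\<^sub>R w) + f x =
     s * s * frechet_derivative (\<lambda>y. frechet_derivative f (at y) v) (at (x + a *\<^sub>R v + b *\<^sub>R w)) w"
proof -
  have d1: "f differentiable (at y)" if "y \<in> S" for y
    using f that by (simp add: numeral_2_eq_2)
  have d2: "(\<lambda>y. frechet_derivative f (at y) v) differentiable (at y)" if "y \<in> S" for y
    using f that by (simp add: numeral_2_eq_2)
  let ?D = "\<lambda>y. frechet_derivative f (at y) v"
  have "((\<lambda>a. f (x + s *\<^sub>R w + a *\<^sub>R v) - f (x + a *\<^sub>R v)) has_real_derivative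
      (?D (x + s *\<^sub>R w + a *\<^sub>R v) - ?D (x + a *\<^sub>R v))) (at a)" if "0 \<le> a" "a \<le> s" for a
    using S[of a s] S[of a 0] that s
    by (intro DERIV_diff has_real_derivative_along_line d1) (auto simp: algebra_simps)
  from MVT2[OF s this] obtain a where a: "0 < a" "a < s"
    "f (x + s *\<^sub>R w + s *\<^sub>R v) - f (x + s *\<^sub>R v) - (f (x + s *\<^sub>R w) - f x) =
     s * (?D (x + s *\<^sub>R w + a *\<^sub>R v) - ?D (x + a *\<^sub>R v))"
    by auto
  have "((\<lambda>b. ?D (x + a *\<^sub>R v + b *\<^sub>R w)) has_real_derivative
      frechet_derivative ?D (at (x + a *\<^sub>R v + b *\<^sub>R w)) w) (at b)" if "0 \<le> b" "b \<le> s" for b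
    using S[of a b] that a by (intro has_real_derivative_along_line d2) auto
  from MVT2[OF s this] obtain b where b: "0 < b" "b < s"
    "?D (x + a *\<^sub>R v + s *\<^sub>R w) - ?D (x + a *\<^sub>R v) = s * frechet_derivative ?D (at (x + a *\<^sub>R v + b *\<^sub>R w)) w"
    by auto
  show thesis
    by (rule that[OF a(1,2) b(1,2)]) (use a(3) b(3) in \<open>simp add: algebra_simps\<close>)
qed

lemma frechet_derivative_swap_real:
  fixes f :: "'a::real_normed_vector \<Rightarrow> real"
  assumes "open S" "x \<in> S" "Ck_on 2 S f"
  shows "frechet_derivative (\<lambda>y. frechet_derivative f (at y) v) (at x) w =
         frechet_derivative (\<lambda>y. frechet_derivative f (at y) w) (at x) v"
proof -
  define V where "V = (\<lambda>y. frechet_derivative (\<lambda>y. frechet_derivative f (at y) v) (at y) w)"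
  define W where "W = (\<lambda>y. frechet_derivative (\<lambda>y. frechet_derivative f (at y) w) (at y) v)"
  have cV: "isCont V x" and cW: "isCont W x"
    using assms by (auto simp: V_def W_def numeral_2_eq_2 continuous_on_eq_continuous_at)
  have "dist (V x) (W x) \<le> e" if e: "e > 0" for e
  proof -
    obtain d1 where d1: "d1 > 0" "\<And>y. dist y x < d1 \<Longrightarrow> dist (V y) (V x) < e/2"
      using cV half_gt_zero[OF e] unfolding continuous_at_eps_delta by blast
    obtain d2 where d2: "d2 > 0" "\<And>y. dist y x < d2 \<Longrightarrow> dist (W y) (W x) < e/2"
      using cW half_gt_zero[OF e] unfolding continuous_at_eps_delta by blast
    obtain d3 where d3: "d3 > 0" "\<And>y. dist y x < d3 \<Longrightarrow> y \<in> S"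
      using assms(1,2) by (metis open_dist)
    define d where "d = min d1 (min d2 d3)"
    \<comment> \<open>With this side length the parallelogram spanned at \<open>x\<close> has radius
      at most \<open>d / 2\<close>; the summand 1 keeps the denominator positive when both
      directions vanish.\<close>
    define s where "s = d / (2 * (norm v + norm w + 1))"
    have d0: "d > 0" using d1 d2 d3 by (simp add: d_def)
    have n: "norm v + norm w + 1 > 0" by (simp add: add_nonneg_pos)
    have s0: "s > 0" using d0 n by (simp add: s_def)
    have close: "dist (x + a *\<^sub>R p + b *\<^sub>R q) x < d"
      if "0 \<le> a" "a \<le> s" "0 \<le> b" "b \<le> s" "{p, q} = {v, w}" for a b p q
    proof -
      have "norm (a *\<^sub>R p + b *\<^sub>R q) \<le> a * norm p + b * norm q"
        using norm_triangle_ineq[of "a *\<^sub>R p" "b *\<^sub>R q"] that by simp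
      also have "\<dots> \<le> s * norm p + s * norm q"
        using that by (intro add_mono mult_right_mono) auto
      also have "\<dots> = s * (norm v + norm w)"
        using that(5) by (auto simp: doubleton_eq_iff algebra_simps)
      also have "\<dots> \<le> s * (norm v + norm w + 1)"
        using s0 by simp
      also have "\<dots> = d / 2" using n by (simp add: s_def field_simps)
      also have "\<dots> < d" using d0 by simp
      finally show ?thesis by (simp add: dist_norm add.assoc)
    qed
    have S1: "x + a *\<^sub>R v + b *\<^sub>R w \<in> S" if "0 \<le> a" "a \<le> s" "0 \<le> b" "b \<le> s" for a b
      using close[OF that, of v w] d3 by (simp add: d_def)
    have S2: "x + a *\<^sub>R w + b *\<^sub>R v \<in> S" if "0 \<le> a" "a \<le> s" "0 \<le> b" "b \<le> s" for a b
      using close[OF that, of w v] d3 by (simp add: d_def insert_commute)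
    obtain a b where ab: "0 < a" "a < s" "0 < b" "b < s"
      "f (x + s *\<^sub>R v + s *\<^sub>R w) - f (x + s *\<^sub>R v) - f (x + s *\<^sub>R w) + f x = s * s * V (x + a *\<^sub>R v + b *\<^sub>R w)"
      unfolding V_def by (rule second_difference_mvt[OF S1 s0 assms(3)]) blast+
    obtain a' b' where ab': "0 < a'" "a' < s" "0 < b'" "b' < s"
      "f (x + s *\<^sub>R w + s *\<^sub>R v) - f (x + s *\<^sub>R w) - f (x + s *\<^sub>R v) + f x = s * s * W (x + a' *\<^sub>R w + b' *\<^sub>R v)"
      unfolding W_def by (rule second_difference_mvt[OF S2 s0 assms(3)]) blast+
    have "s * s * V (x + a *\<^sub>R v + b *\<^sub>R w) = s * s * W (x + a' *\<^sub>R w + b' *\<^sub>R v)"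
      using ab(5) ab'(5) by (simp add: algebra_simps)
    then have eq: "V (x + a *\<^sub>R v + b *\<^sub>R w) = W (x + a' *\<^sub>R w + b' *\<^sub>R v)"
      using s0 by simp
    have "dist (V (x + a *\<^sub>R v + b *\<^sub>R w)) (V x) < e/2"
      using close[of a b v w] ab by (intro d1) (simp add: d_def)
    moreover have "dist (W (x + a' *\<^sub>R w + b' *\<^sub>R v)) (W x) < e/2"
      using close[of a' b' w v] ab' by (intro d2) (simp add: d_def insert_commute)
    ultimately show ?thesis
      using eq unfolding dist_real_def by linarith
  qed
  then have "dist (V x) (W x) \<le> 0"
    by (rule field_le_epsilon) simp
  then have "V x = W x" by simp
  then show ?thesis by (simp add: V_def W_def)
qed

lemma frechet_derivative_swap:
  fixes f :: "'a::real_normed_vector \<Rightarrow> 'b::euclidean_space"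
  assumes "open S" "x \<in> S" "Ck_on 2 S f"
  shows "frechet_derivative (\<lambda>y. frechet_derivative f (at y) v) (at x) w =
         frechet_derivative (\<lambda>y. frechet_derivative f (at y) w) (at x) v"
proof (rule euclidean_eqI)
  fix b :: 'b
  have bl: "bounded_linear (\<lambda>z. z \<bullet> b)" by (rule bounded_linear_inner_left)
  have d: "f differentiable (at y)" "(\<lambda>y. frechet_derivative f (at y) u) differentiable (at y)"
    if "y \<in> S" for y u
    using assms(3) that by (auto simp: numeral_2_eq_2)
  have 1: "frechet_derivative (\<lambda>y. f y \<bullet> b) (at y) = (\<lambda>u. frechet_derivative f (at y) u \<bullet> b)"
    if "y \<in> S" for y
    by (intro frechet_derivative_eqI bounded_linear.has_derivative[OF bl] differentiable_has_frechet d that)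
  have 2: "frechet_derivative (\<lambda>y. frechet_derivative (\<lambda>y. f y \<bullet> b) (at y) u) (at x) =
      (\<lambda>z. frechet_derivative (\<lambda>y. frechet_derivative f (at y) u) (at x) z \<bullet> b)" for u
  proof (rule frechet_derivative_eqI, rule has_derivative_transform_within_open[OF _ assms(1,2)])
    show "((\<lambda>y. frechet_derivative f (at y) u \<bullet> b) has_derivative
       (\<lambda>z. frechet_derivative (\<lambda>y. frechet_derivative f (at y) u) (at x) z \<bullet> b)) (at x)"
      by (intro bounded_linear.has_derivative[OF bl] differentiable_has_frechet d assms)
  qed (simp add: 1)
  show "frechet_derivative (\<lambda>y. frechet_derivative f (at y) v) (at x) w \<bullet> b =
        frechet_derivative (\<lambda>y. frechet_derivative f (at y) w) (at x) v \<bullet> b"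
    using frechet_derivative_swap_real[OF assms(1,2) Ck_on_linear[OF assms(1) bl assms(3)], of v w]
    by (simp add: 2)
qed

section \<open>Tangent vectors and vector fields in charts\<close>

lemma of_real_vector_smult: "of_real r *s (x :: complex^'n) = r *\<^sub>R x"
  by (simp add: vec_eq_iff scaleR_conv_of_real[where 'a = complex])

lemma tscale_apply: "tscale a u c = a *s u c"
  by (simp add: tscale_def)

lemma tscale_of_real: "tscale (of_real r) u c = r *\<^sub>R u c"
  by (simp add: tscale_def of_real_vector_smult)

lemma cJ_apply: "cJ u c = \<i> *s u c"
  by (simp add: cJ_def tscale_def)

lemma linear_vector_smult: "linear (\<lambda>x. a *s (x :: complex^'n))"
  by (rule linearI) (simp_all add: vec_eq_iff algebra_simps)

lemma bounded_linear_vector_smult: "bounded_linear (\<lambda>x. a *s (x :: complex^'n))"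
  by (rule linear_conv_bounded_linear[THEN iffD1, OF linear_vector_smult])

locale cmanifold =
  fixes M :: "'a topology" and A :: "('a, 'n::finite) chart set"
  assumes complex_manifold: "complex_manifold M A"
begin

lemma chart_openin: "c \<in> A \<Longrightarrow> openin M (fst c)"
  using complex_manifold by (simp add: complex_manifold_def complex_atlas_def)

lemma chart_homeo:
  "c \<in> A \<Longrightarrow> homeomorphic_map (subtopology M (fst c)) (top_of_set (snd c ` fst c)) (snd c)"
  using complex_manifold by (simp add: complex_manifold_def complex_atlas_def)

lemma chart_image_open: "c \<in> A \<Longrightarrow> open (snd c ` fst c)"
  using complex_manifold by (simp add: complex_manifold_def complex_atlas_def)

lemma chart_subset: "c \<in> A \<Longrightarrow> fst c \<subseteq> topspace M"
  using chart_openin openin_subset by blast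

lemma chart_exists: "p \<in> topspace M \<Longrightarrow> \<exists>c\<in>A. p \<in> fst c"
  using complex_manifold by (auto simp: complex_manifold_def complex_atlas_def)

lemma chart_inj: "c \<in> A \<Longrightarrow> inj_on (snd c) (fst c)"
  using homeomorphic_imp_injective_map[OF chart_homeo] chart_subset
  by (simp add: Int_absorb1)

lemma chart_inv_left [simp]: "c \<in> A \<Longrightarrow> p \<in> fst c \<Longrightarrow> chart_inv c (snd c p) = p"
  by (simp add: chart_inv_def chart_inj)

lemma open_chart_image:
  assumes "c \<in> A" "openin M W"
  shows "open (snd c ` (W \<inter> fst c))"
proof -
  have "openin (subtopology M (fst c)) (W \<inter> fst c)"
    using assms(2) by (auto simp: openin_subtopology)
  then have "openin (top_of_set (snd c ` fst c)) (snd c ` (W \<inter> fst c))"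
    using homeomorphic_imp_open_map[OF chart_homeo[OF assms(1)]] by (simp add: open_map_def)
  then show ?thesis
    using chart_image_open[OF assms(1)] openin_open_eq by blast
qed

lemma open_chart_image_sub:
  assumes "c \<in> A" "openin M W" "W \<subseteq> fst c"
  shows "open (snd c ` W)"
  using open_chart_image[OF assms(1,2)] assms(3) by (simp add: Int_absorb2)

section \<open>Coordinate changes and their differentials\<close>

lemma transition_holomorphic:
  "c \<in> A \<Longrightarrow> d \<in> A \<Longrightarrow> holomorphic_map_on (snd c ` (fst c \<inter> fst d)) (snd d \<circ> chart_inv c)"
  using complex_manifold by (auto simp: complex_manifold_def complex_atlas_def)

lemma transition_smooth:
  "c \<in> A \<Longrightarrow> d \<in> A \<Longrightarrow> smooth_on (snd c ` (fst c \<inter> fst d)) (snd d \<circ> chart_inv c)"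
  using transition_holomorphic by (auto simp: holomorphic_map_on_def)

lemma transition_differentiable:
  "c \<in> A \<Longrightarrow> d \<in> A \<Longrightarrow> p \<in> fst c \<Longrightarrow> p \<in> fst d \<Longrightarrow> (snd d \<circ> chart_inv c) differentiable (at (snd c p))"
  by (rule smooth_on_differentiable[OF transition_smooth]) auto

lemma transition_deriv_linear:
  "c \<in> A \<Longrightarrow> d \<in> A \<Longrightarrow> p \<in> fst c \<Longrightarrow> p \<in> fst d \<Longrightarrow> linear (transition_deriv c d p)"
  unfolding transition_deriv_def by (rule linear_frechet_derivative[OF transition_differentiable])

lemma transition_deriv_smult:
  "c \<in> A \<Longrightarrow> d \<in> A \<Longrightarrow> p \<in> fst c \<Longrightarrow> p \<in> fst d \<Longrightarrow>
     transition_deriv c d p (a *s v) = a *s transition_deriv c d p v"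
  using transition_holomorphic[of c d] by (auto simp: holomorphic_map_on_def transition_deriv_def)

lemma chain_rule_transition:
  assumes "c \<in> A" "d \<in> A" "p \<in> fst c" "p \<in> fst d" "(f \<circ> chart_inv d) differentiable (at (snd d p))"
  shows "((f \<circ> chart_inv c) has_derivative
    (\<lambda>v. frechet_derivative (f \<circ> chart_inv d) (at (snd d p)) (transition_deriv c d p v))) (at (snd c p))"
proof (rule has_derivative_transform_within_open)
  show "open (snd c ` (fst d \<inter> fst c))"
    using open_chart_image[OF assms(1) chart_openin[OF assms(2)]] .
  show "snd c p \<in> snd c ` (fst d \<inter> fst c)" using assms by auto
  have "((snd d \<circ> chart_inv c) has_derivative transition_deriv c d p) (at (snd c p))"
    unfolding transition_deriv_def
    by (rule differentiable_has_frechet[OF transition_differentiable]) (use assms in auto)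
  moreover have "((f \<circ> chart_inv d) has_derivative frechet_derivative (f \<circ> chart_inv d) (at (snd d p)))
      (at ((snd d \<circ> chart_inv c) (snd c p)))"
    using differentiable_has_frechet[OF assms(5)] assms by simp
  ultimately show "((f \<circ> chart_inv d) \<circ> (snd d \<circ> chart_inv c) has_derivative
      (\<lambda>v. frechet_derivative (f \<circ> chart_inv d) (at (snd d p)) (transition_deriv c d p v))) (at (snd c p))"
    using diff_chain_at by (fastforce simp: comp_def)
  show "((f \<circ> chart_inv d) \<circ> (snd d \<circ> chart_inv c)) y = (f \<circ> chart_inv c) y"
    if "y \<in> snd c ` (fst d \<inter> fst c)" for y
    using that assms by auto
qed

lemma transition_deriv_cocycle:
  assumes "c \<in> A" "d \<in> A" "e \<in> A" "p \<in> fst c" "p \<in> fst d" "p \<in> fst e"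
  shows "transition_deriv d e p (transition_deriv c d p v) = transition_deriv c e p v"
  unfolding transition_deriv_def[of d e] transition_deriv_def[of c e]
  by (subst frechet_derivative_eqI[OF chain_rule_transition[OF assms(1,2,4,5)
          transition_differentiable[OF assms(2,3,5,6)]]]) (rule refl)

lemma transition_deriv_self:
  assumes "c \<in> A" "p \<in> fst c"
  shows "transition_deriv c c p v = v"
proof -
  have "((snd c \<circ> chart_inv c) has_derivative (\<lambda>v. v)) (at (snd c p))"
    by (rule has_derivative_transform_within_open[OF has_derivative_ident chart_image_open[OF assms(1)]])
      (use assms in auto)
  from frechet_derivative_eqI[OF this] show ?thesis by (simp add: transition_deriv_def)
qed

section \<open>Tangent vectors, coordinate fields and smooth fields\<close>

lemma tangent_transition:
  "u \<in> tangent_space A p \<Longrightarrow> c \<in> A \<Longrightarrow> d \<in> A \<Longrightarrow> p \<in> fst c \<Longrightarrow> p \<in> fst d \<Longrightarrow>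
     u d = transition_deriv c d p (u c)"
  unfolding tangent_space_def by blast

lemma tangent_outside: "u \<in> tangent_space A p \<Longrightarrow> c \<notin> A \<or> p \<notin> fst c \<Longrightarrow> u c = 0"
  unfolding tangent_space_def by blast

lemma tangent_spaceI:
  assumes "\<And>c d. c \<in> A \<Longrightarrow> d \<in> A \<Longrightarrow> p \<in> fst c \<Longrightarrow> p \<in> fst d \<Longrightarrow> u d = transition_deriv c d p (u c)"
    and "\<And>c. c \<notin> A \<or> p \<notin> fst c \<Longrightarrow> u c = 0"
  shows "u \<in> tangent_space A p"
  unfolding tangent_space_def using assms by blast

lemma tangent_add:
  assumes "u \<in> tangent_space A p" "v \<in> tangent_space A p"
  shows "u + v \<in> tangent_space A p"
proof (rule tangent_spaceI)
  fix c d assume cd: "c \<in> A" "d \<in> A" "p \<in> fst c" "p \<in> fst d"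
  show "(u + v) d = transition_deriv c d p ((u + v) c)"
    unfolding plus_fun_apply linear_add[OF transition_deriv_linear[OF cd]]
    by (rule arg_cong2[where f = "(+)"]; rule tangent_transition) (use assms cd in auto)
qed (simp add: tangent_outside[OF assms(1)] tangent_outside[OF assms(2)])

lemma tangent_tscale:
  assumes "u \<in> tangent_space A p"
  shows "tscale a u \<in> tangent_space A p"
proof (rule tangent_spaceI)
  fix c d assume cd: "c \<in> A" "d \<in> A" "p \<in> fst c" "p \<in> fst d"
  show "tscale a u d = transition_deriv c d p (tscale a u c)"
    unfolding tscale_apply transition_deriv_smult[OF cd]
    by (subst tangent_transition[OF assms cd]) (rule refl)
qed (simp add: tscale_apply tangent_outside[OF assms])

lemma tangent_zero: "0 \<in> tangent_space A p"
  by (rule tangent_spaceI) (auto simp: linear_0[OF transition_deriv_linear])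

text \<open>One chart determines the vector: the components in other charts around \<open>p\<close>
  follow by the coordinate changes, and all remaining ones are 0 by convention. Later identities
  between tangent vectors are checked in a single chart this way.\<close>

lemma tangent_eqI:
  assumes "u \<in> tangent_space A p" "v \<in> tangent_space A p" "c \<in> A" "p \<in> fst c" "u c = v c"
  shows "u = v"
proof
  fix d
  show "u d = v d"
    using tangent_transition[OF assms(1) assms(3), of d] tangent_transition[OF assms(2) assms(3), of d]
      tangent_outside[OF assms(1), of d] tangent_outside[OF assms(2), of d] assms
    by metis
qed

text \<open>For \<open>a\<close> in the real basis \<open>Basis\<close> these are the coordinate
  fields d/dx and d/dy of the chart. Their components in \<open>c\<close> are constant there, so
  their derivatives and Lie brackets vanish. The guard on \<open>c\<close> and \<open>p\<close>
  makes \<open>coord_field_smult\<close> an unconditional equation between functions.\<close>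

definition coord_field :: "('a, 'n) chart \<Rightarrow> complex^'n \<Rightarrow> 'a \<Rightarrow> ('a, 'n) tvec" where
  "coord_field c a p = (\<lambda>d. if c \<in> A \<and> d \<in> A \<and> p \<in> fst c \<and> p \<in> fst d then transition_deriv c d p a else 0)"

lemma coord_field_tangent: "c \<in> A \<Longrightarrow> p \<in> fst c \<Longrightarrow> coord_field c a p \<in> tangent_space A p"
  unfolding tangent_space_def by (auto simp: coord_field_def transition_deriv_cocycle)

lemma coord_field_self: "c \<in> A \<Longrightarrow> p \<in> fst c \<Longrightarrow> coord_field c a p c = a"
  by (simp add: coord_field_def transition_deriv_self)

lemma smooth_fun_chartI:
  fixes f :: "'a \<Rightarrow> 'b::real_normed_vector"
  assumes "c \<in> A" "openin M W" "W \<subseteq> fst c" "smooth_on (snd c ` W) (f \<circ> chart_inv c)"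
  shows "smooth_fun A W f"
  unfolding smooth_fun_def
proof
  fix d assume d: "d \<in> A"
  let ?S = "snd d ` (W \<inter> fst d)"
  have o: "open ?S" using open_chart_image[OF d assms(2)] .
  have "smooth_on ?S ((f \<circ> chart_inv c) \<circ> (snd c \<circ> chart_inv d))"
  proof (rule smooth_on_compose[OF o _ _ assms(4)])
    show "(snd c \<circ> chart_inv d) ` ?S \<subseteq> snd c ` W" using d by auto
    show "smooth_on ?S (snd c \<circ> chart_inv d)"
      by (rule smooth_on_subset[OF transition_smooth[OF d assms(1)]]) (use assms in auto)
  qed
  then show "smooth_on ?S (f \<circ> chart_inv d)"
    by (subst smooth_on_cong[OF o, where g = "(f \<circ> chart_inv c) \<circ> (snd c \<circ> chart_inv d)"])
      (use assms d in auto)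
qed

text \<open>The components in another chart are the differential of the coordinate change, taken at
  a moving point and applied to the components in \<open>c\<close>; this is what
  \<open>smooth_on_apply\<close> handles.\<close>

lemma vector_field_chartI:
  assumes "c \<in> A" "openin M W" "W \<subseteq> fst c" "\<And>p. p \<in> W \<Longrightarrow> X p \<in> tangent_space A p"
    and "smooth_on (snd c ` W) (\<lambda>y. X (chart_inv c y) c)"
  shows "vector_field A W X"
  unfolding vector_field_def
proof (intro conjI ballI)
  fix d assume d: "d \<in> A"
  let ?S = "snd d ` (W \<inter> fst d)" and ?\<tau> = "snd d \<circ> chart_inv c" and ?\<sigma> = "snd c \<circ> chart_inv d"
  have o: "open ?S" using open_chart_image[OF d assms(2)] .
  have \<sigma>: "smooth_on ?S ?\<sigma>"
    by (rule smooth_on_subset[OF transition_smooth[OF d assms(1)]]) (use assms in auto)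
  have "smooth_on ?S (\<lambda>y. frechet_derivative ?\<tau> (at (?\<sigma> y)) (X (chart_inv c (?\<sigma> y)) c))"
  proof (rule smooth_on_apply[OF o, where F = "\<lambda>y. frechet_derivative ?\<tau> (at (?\<sigma> y))"])
    fix y assume "y \<in> ?S"
    then show "linear (frechet_derivative ?\<tau> (at (?\<sigma> y)))"
      using transition_differentiable[OF assms(1) d] assms d
      by (auto intro!: linear_frechet_derivative)
  next
    fix v
    have "smooth_on ?S ((\<lambda>z. frechet_derivative ?\<tau> (at z) v) \<circ> ?\<sigma>)"
      by (rule smooth_on_compose[OF o _ \<sigma> smooth_on_frechet[OF transition_smooth[OF assms(1) d]]])
        (use assms d in auto)
    then show "smooth_on ?S (\<lambda>y. frechet_derivative ?\<tau> (at (?\<sigma> y)) v)"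
      by (simp add: comp_def)
  next
    have "smooth_on ?S ((\<lambda>y. X (chart_inv c y) c) \<circ> ?\<sigma>)"
      by (rule smooth_on_compose[OF o _ \<sigma> assms(5)]) (use assms d in auto)
    then show "smooth_on ?S (\<lambda>y. X (chart_inv c (?\<sigma> y)) c)"
      by (simp add: comp_def)
  qed
  moreover have "X (chart_inv d y) d = frechet_derivative ?\<tau> (at (?\<sigma> y)) (X (chart_inv c (?\<sigma> y)) c)"
    if "y \<in> ?S" for y
    using that assms d tangent_transition[OF assms(4) assms(1) d]
    by (auto simp: transition_deriv_def)
  ultimately show "smooth_on ?S (\<lambda>y. X (chart_inv d y) d)"
    using smooth_on_cong[OF o] by (metis (no_types, lifting))
qed (use assms in auto)

lemma vector_field_tangent: "vector_field A W X \<Longrightarrow> p \<in> W \<Longrightarrow> X p \<in> tangent_space A p"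
  by (simp add: vector_field_def)

lemma vector_field_smooth:
  "vector_field A W X \<Longrightarrow> c \<in> A \<Longrightarrow> smooth_on (snd c ` (W \<inter> fst c)) (\<lambda>y. X (chart_inv c y) c)"
  by (simp add: vector_field_def)

lemma vector_field_subset:
  assumes "vector_field A W X" "W' \<subseteq> W"
  shows "vector_field A W' X"
  unfolding vector_field_def
proof (intro conjI ballI)
  fix c assume "c \<in> A"
  then show "smooth_on (snd c ` (W' \<inter> fst c)) (\<lambda>y. X (chart_inv c y) c)"
    by (rule smooth_on_subset[OF vector_field_smooth[OF assms(1)]]) (use assms(2) in auto)
qed (use assms vector_field_tangent in auto)

lemma vector_field_cong:
  assumes "openin M W" "\<And>p. p \<in> W \<Longrightarrow> X p = Y p" "vector_field A W X"
  shows "vector_field A W Y"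
  unfolding vector_field_def
proof (intro conjI ballI)
  fix c assume c: "c \<in> A"
  have "X (chart_inv c y) c = Y (chart_inv c y) c" if "y \<in> snd c ` (W \<inter> fst c)" for y
    using that assms(2) c by auto
  then show "smooth_on (snd c ` (W \<inter> fst c)) (\<lambda>y. Y (chart_inv c y) c)"
    using smooth_on_cong[OF open_chart_image[OF c assms(1)]] vector_field_smooth[OF assms(3) c]
    by (metis (no_types, lifting))
qed (use assms vector_field_tangent in metis)

lemma vector_field_add:
  assumes "openin M W" "vector_field A W X" "vector_field A W Y"
  shows "vector_field A W (X + Y)"
  unfolding vector_field_def
proof (intro conjI ballI)
  fix c assume c: "c \<in> A"
  show "smooth_on (snd c ` (W \<inter> fst c)) (\<lambda>y. (X + Y) (chart_inv c y) c)"
    using smooth_on_add[OF open_chart_image[OF c assms(1)] vector_field_smooth[OF assms(2) c]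
        vector_field_smooth[OF assms(3) c]] by simp
qed (use assms vector_field_tangent tangent_add in auto)

lemma vector_field_tscale:
  assumes "openin M W" "vector_field A W X"
  shows "vector_field A W (\<lambda>p. tscale a (X p))"
  unfolding vector_field_def
proof (intro conjI ballI)
  fix c assume c: "c \<in> A"
  show "smooth_on (snd c ` (W \<inter> fst c)) (\<lambda>y. tscale a (X (chart_inv c y)) c)"
    using smooth_on_linear[OF open_chart_image[OF c assms(1)] bounded_linear_vector_smult
        vector_field_smooth[OF assms(2) c]] by (simp add: tscale_apply)
qed (use assms vector_field_tangent tangent_tscale in auto)

lemma vector_field_zero: "vector_field A W 0"
  unfolding vector_field_def by (auto simp: tangent_zero smooth_on_const)

lemma vector_field_diff:
  assumes "openin M W" "vector_field A W X" "vector_field A W Y"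
  shows "vector_field A W (X - Y)"
proof -
  have "X - Y = X + (\<lambda>p. tscale (-1) (Y p))"
    by (simp add: fun_eq_iff tscale_apply)
  then show ?thesis
    using vector_field_add[OF assms(1,2) vector_field_tscale[OF assms(1,3)]] by metis
qed

lemma smooth_fun_smooth:
  "smooth_fun A W f \<Longrightarrow> c \<in> A \<Longrightarrow> smooth_on (snd c ` (W \<inter> fst c)) (f \<circ> chart_inv c)"
  by (simp add: smooth_fun_def)

lemma vector_field_scale_fun:
  assumes "openin M W" "smooth_fun A W (f :: 'a \<Rightarrow> real)" "vector_field A W X"
  shows "vector_field A W (\<lambda>p. tscale (of_real (f p)) (X p))"
  unfolding vector_field_def
proof (intro conjI ballI)
  fix c assume c: "c \<in> A"
  show "smooth_on (snd c ` (W \<inter> fst c)) (\<lambda>y. tscale (of_real (f (chart_inv c y))) (X (chart_inv c y)) c)"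
    unfolding tscale_of_real
    by (rule smooth_on_bilinear[OF open_chart_image[OF c assms(1)] bounded_bilinear_scaleR])
      (use smooth_fun_smooth[OF assms(2) c] vector_field_smooth[OF assms(3) c] in \<open>auto simp: comp_def\<close>)
qed (use assms vector_field_tangent tangent_tscale in auto)

lemma coord_field_vector_field:
  assumes "c \<in> A"
  shows "vector_field A (fst c) (coord_field c a)"
proof (rule vector_field_chartI[OF assms chart_openin[OF assms] order_refl coord_field_tangent[OF assms]])
  show "smooth_on (snd c ` fst c) (\<lambda>y. coord_field c a (chart_inv c y) c)"
    by (subst smooth_on_cong[OF chart_image_open[OF assms], where g = "\<lambda>y. a"])
      (use assms in \<open>auto simp: coord_field_self smooth_on_const\<close>)
qed

lemma deriv_along_eq:
  assumes "c \<in> A" "p \<in> fst c" "u \<in> tangent_space A p" "(f \<circ> chart_inv c) differentiable (at (snd c p))"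
  shows "deriv_along A p u f = frechet_derivative (f \<circ> chart_inv c) (at (snd c p)) (u c)"
  unfolding deriv_along_def
proof (rule the_equality)
  show "\<forall>d\<in>A. p \<in> fst d \<longrightarrow> frechet_derivative (f \<circ> chart_inv d) (at (snd d p)) (u d) =
      frechet_derivative (f \<circ> chart_inv c) (at (snd c p)) (u c)"
  proof (intro ballI impI)
    fix d assume d: "d \<in> A" "p \<in> fst d"
    show "frechet_derivative (f \<circ> chart_inv d) (at (snd d p)) (u d) =
      frechet_derivative (f \<circ> chart_inv c) (at (snd c p)) (u c)"
      using frechet_derivative_eqI[OF chain_rule_transition[OF d(1) assms(1) d(2) assms(2,4)]]
        tangent_transition[OF assms(3) d(1) assms(1) d(2) assms(2)] by simp
  qed
qed (use assms in blast)

end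

section \<open>Affine connections and their curvature in charts\<close>

lemma sum_fun_apply: "(\<Sum>i\<in>I. g i) x = (\<Sum>i\<in>I. g i x)"
  for g :: "'i \<Rightarrow> 'c \<Rightarrow> 'd::comm_monoid_add"
  by (induction I rule: infinite_finite_induct) auto

text \<open>The curvature R(a, b)e of the connection with Christoffel symbols \<open>G\<close>,
  computed on constant fields; these commute, so there is no bracket term.\<close>

definition chart_curvature ::
  "('e::real_normed_vector \<Rightarrow> 'e \<Rightarrow> 'e \<Rightarrow> 'e) \<Rightarrow> 'e \<Rightarrow> 'e \<Rightarrow> 'e \<Rightarrow> 'e \<Rightarrow> 'e" where
  "chart_curvature G y a b e =
     frechet_derivative (\<lambda>z. G z b e) (at y) a - frechet_derivative (\<lambda>z. G z a e) (at y) b +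
     G y a (G y b e) - G y b (G y a e)"

lemma (in cmanifold) tangent_diff:
  assumes "u \<in> tangent_space A p" "v \<in> tangent_space A p"
  shows "u - v \<in> tangent_space A p"
proof -
  have "u - v = u + tscale (-1) v" by (simp add: fun_eq_iff tscale_apply)
  then show ?thesis using tangent_add[OF assms(1) tangent_tscale[OF assms(2)]] by metis
qed

lemma (in cmanifold) coord_field_expansion:
  assumes "c \<in> A" "p \<in> fst c" "u \<in> tangent_space A p"
  shows "u = (\<Sum>i\<in>Basis. tscale (of_real (u c \<bullet> i)) (coord_field c i p))"
proof (rule tangent_eqI[OF assms(3) _ assms(1,2)])
  have "(\<Sum>i\<in>I. tscale (of_real (u c \<bullet> i)) (coord_field c i p)) \<in> tangent_space A p" for I
  proof (induction I rule: infinite_finite_induct)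
    case (insert i I)
    then show ?case
      using tangent_add[OF tangent_tscale[OF coord_field_tangent[OF assms(1,2)]] insert.IH]
      by (simp add: insert.hyps plus_fun_def)
  qed (simp_all only: sum.infinite sum.empty tangent_zero not_False_eq_True)
  then show "(\<Sum>i\<in>Basis. tscale (of_real (u c \<bullet> i)) (coord_field c i p)) \<in> tangent_space A p" .
  show "u c = (\<Sum>i\<in>Basis. tscale (of_real (u c \<bullet> i)) (coord_field c i p)) c"
    by (simp add: sum_fun_apply tscale_of_real coord_field_self assms euclidean_representation)
qed

locale affine_manifold = cmanifold M A
  for M :: "'a topology" and A :: "('a, 'n::finite) chart set" +
  fixes nabla :: "('a \<Rightarrow> ('a, 'n) tvec) \<Rightarrow> ('a \<Rightarrow> ('a, 'n) tvec) \<Rightarrow> 'a \<Rightarrow> ('a, 'n) tvec"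
  assumes affine: "affine_connection M A nabla"
begin

lemma nabla_vector_field:
  "openin M W \<Longrightarrow> vector_field A W X \<Longrightarrow> vector_field A W Y \<Longrightarrow> vector_field A W (nabla X Y)"
  using affine[unfolded affine_connection_def, rule_format, of W,
    THEN conjunct1, rule_format, of X Y] by blast

lemma nabla_add_left:
  "openin M W \<Longrightarrow> vector_field A W X \<Longrightarrow> vector_field A W X' \<Longrightarrow> vector_field A W Y \<Longrightarrow> p \<in> W \<Longrightarrow>
     nabla (X + X') Y p = nabla X Y p + nabla X' Y p"
  using affine[unfolded affine_connection_def, rule_format, of W,
    THEN conjunct2, THEN conjunct1, rule_format, of X X' Y p] by blast

lemma nabla_scale_left:
  fixes f :: "'a \<Rightarrow> real"
  shows "openin M W \<Longrightarrow> smooth_fun A W f \<Longrightarrow> vector_field A W X \<Longrightarrow> vector_field A W Y \<Longrightarrow> p \<in> W \<Longrightarrow>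
     nabla (\<lambda>q. tscale (of_real (f q)) (X q)) Y p = tscale (of_real (f p)) (nabla X Y p)"
  using affine[unfolded affine_connection_def, rule_format, of W,
    THEN conjunct2, THEN conjunct2, THEN conjunct1, rule_format, of f X Y p] by blast

lemma nabla_add_right:
  "openin M W \<Longrightarrow> vector_field A W X \<Longrightarrow> vector_field A W Y \<Longrightarrow> vector_field A W Y' \<Longrightarrow> p \<in> W \<Longrightarrow>
     nabla X (Y + Y') p = nabla X Y p + nabla X Y' p"
  using affine[unfolded affine_connection_def, rule_format, of W,
    THEN conjunct2, THEN conjunct2, THEN conjunct2, THEN conjunct1, rule_format, of X Y Y' p] by blast

lemma nabla_leibniz:
  fixes f :: "'a \<Rightarrow> real"
  shows "openin M W \<Longrightarrow> smooth_fun A W f \<Longrightarrow> vector_field A W X \<Longrightarrow> vector_field A W Y \<Longrightarrow> p \<in> W \<Longrightarrow>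
     nabla X (\<lambda>q. tscale (of_real (f q)) (Y q)) p =
     tscale (of_real (deriv_along A p (X p) f)) (Y p) + tscale (of_real (f p)) (nabla X Y p)"
  using affine[unfolded affine_connection_def, rule_format, of W,
    THEN conjunct2, THEN conjunct2, THEN conjunct2, THEN conjunct2, rule_format, of f X Y p] by blast

text \<open>Cutting a field off by the characteristic function of \<open>W\<close>, which is smooth over \<open>W\<close>, shows
  that only the restrictions to \<open>W\<close> matter.\<close>

lemma nabla_cong:
  assumes W: "openin M W" "p \<in> W"
    and X: "vector_field A W X" "\<And>q. q \<in> W \<Longrightarrow> X q = X' q"
    and Y: "vector_field A W Y" "\<And>q. q \<in> W \<Longrightarrow> Y q = Y' q"
  shows "nabla X Y p = nabla X' Y' p"
proof -
  define f :: "'a \<Rightarrow> real" where "f = (\<lambda>q. if q \<in> W then 1 else 0)"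
  have f_near: "(f \<circ> chart_inv c) y = 1" if "c \<in> A" "y \<in> snd c ` (W \<inter> fst c)" for c y
    using that by (auto simp: f_def)
  have f: "smooth_fun A W f"
    unfolding smooth_fun_def
  proof
    fix c assume c: "c \<in> A"
    show "smooth_on (snd c ` (W \<inter> fst c)) (f \<circ> chart_inv c)"
      by (subst smooth_on_cong[OF open_chart_image[OF c W(1)] f_near[OF c], of "\<lambda>x. x"])
        (simp_all add: smooth_on_const)
  qed
  have X': "vector_field A W X'" and Y': "vector_field A W Y'"
    using vector_field_cong[OF W(1)] X Y by blast+
  have p: "p \<in> topspace M" using W openin_subset by auto
  obtain c where c: "c \<in> A" "p \<in> fst c" using chart_exists[OF p] by auto
  \<comment> \<open>\<open>f\<close> is constant near \<open>p\<close>, so the derivative term of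
    the Leibniz rule disappears in \<open>right\<close>.\<close>
  have d: "((f \<circ> chart_inv c) has_derivative (\<lambda>v. 0)) (at (snd c p))"
    by (rule has_derivative_transform_within_open[OF has_derivative_const open_chart_image[OF c(1) W(1)]])
      (use c W f_near in auto)
  have fd: "deriv_along A p u f = 0" if "u \<in> tangent_space A p" for u
    using deriv_along_eq[OF c that, of f] d frechet_derivative_eqI[OF d] by (auto simp: differentiable_def)
  have one: "tscale 1 u = u" and zero: "tscale 0 u = 0" for u :: "('a, 'n) tvec"
    by (auto simp: fun_eq_iff tscale_apply)
  let ?c = "\<lambda>X q. tscale (of_real (f q)) (X q) :: ('a, 'n) tvec"
  have left: "nabla (?c X) Y p = nabla X Y p" if "vector_field A W X" "vector_field A W Y" for X Y
    using nabla_scale_left[OF W(1) f that W(2)] W(2) by (simp add: f_def one)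
  have right: "nabla X (?c Y) p = nabla X Y p" if "vector_field A W X" "vector_field A W Y" for X Y
    using nabla_leibniz[OF W(1) f that W(2)] fd[OF vector_field_tangent[OF that(1) W(2)]] W(2)
    by (simp add: f_def one zero)
  \<comment> \<open>\<open>nabla\<close> takes total functions. After the cut-off the fields vanish
    outside \<open>W\<close> as well, so they are equal as total functions and can be exchanged
    inside \<open>nabla\<close>.\<close>
  have "?c X = ?c X'" and "?c Y = ?c Y'"
    using X(2) Y(2) by (force simp: f_def zero)+
  then show ?thesis
    using left[OF X(1) Y(1)] left[OF X' Y(1)] right[OF X' Y(1)] right[OF X' Y'] by metis
qed

lemma nabla_zero_left:
  assumes "openin M W" "vector_field A W Y" "p \<in> W"
  shows "nabla 0 Y p = 0"
  using nabla_add_left[OF assms(1) vector_field_zero vector_field_zero assms(2,3)] by simp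

lemma nabla_zero_right:
  assumes "openin M W" "vector_field A W X" "p \<in> W"
  shows "nabla X 0 p = 0"
  using nabla_add_right[OF assms(1,2) vector_field_zero vector_field_zero assms(3)] by simp

lemma nabla_sum:
  fixes f :: "'i \<Rightarrow> 'a \<Rightarrow> real"
  assumes W: "openin M W" "p \<in> W" and "finite I"
    and f: "\<And>i. i \<in> I \<Longrightarrow> smooth_fun A W (f i)" and E: "\<And>i. i \<in> I \<Longrightarrow> vector_field A W (E i)"
    and Y: "vector_field A W Y"
  shows "nabla (\<lambda>q. \<Sum>i\<in>I. tscale (of_real (f i q)) (E i q)) Y p =
           (\<Sum>i\<in>I. tscale (of_real (f i p)) (nabla (E i) Y p))" (is ?L)
    and "nabla Y (\<lambda>q. \<Sum>i\<in>I. tscale (of_real (f i q)) (E i q)) p =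
           (\<Sum>i\<in>I. tscale (of_real (deriv_along A p (Y p) (f i))) (E i p) +
                     tscale (of_real (f i p)) (nabla Y (E i) p))" (is ?R)
proof -
  \<comment> \<open>Smoothness of the partial sums is carried through the induction, since the
    additivity axioms require it.\<close>
  have "vector_field A W (\<lambda>q. \<Sum>i\<in>I. tscale (of_real (f i q)) (E i q)) \<and> ?L \<and> ?R"
    using assms(3) f E
  proof (induction I rule: finite_induct)
    case empty
    show ?case
      using nabla_zero_left[OF W(1) Y W(2)] nabla_zero_right[OF W(1) Y W(2)] vector_field_zero
      by (simp add: zero_fun_def)
  next
    case (insert i I)
    let ?s = "\<lambda>q. \<Sum>i\<in>I. tscale (of_real (f i q)) (E i q)"
    let ?t = "\<lambda>q. tscale (of_real (f i q)) (E i q)"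
    have eq: "(\<lambda>q. \<Sum>i\<in>insert i I. tscale (of_real (f i q)) (E i q)) = ?t + ?s"
      using insert.hyps by (simp add: fun_eq_iff)
    have fi: "smooth_fun A W (f i)" and Ei: "vector_field A W (E i)"
      using insert.prems by auto
    have t: "vector_field A W ?t" using vector_field_scale_fun[OF W(1) fi Ei] .
    have IH: "vector_field A W ?s"
      "nabla ?s Y p = (\<Sum>i\<in>I. tscale (of_real (f i p)) (nabla (E i) Y p))"
      "nabla Y ?s p = (\<Sum>i\<in>I. tscale (of_real (deriv_along A p (Y p) (f i))) (E i p) +
                     tscale (of_real (f i p)) (nabla Y (E i) p))"
      using insert.IH[OF insert.prems] by blast+
    have "nabla (?t + ?s) Y p = (\<Sum>i\<in>insert i I. tscale (of_real (f i p)) (nabla (E i) Y p))"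
      unfolding nabla_add_left[OF W(1) t IH(1) Y W(2)] IH(2) nabla_scale_left[OF W(1) fi Ei Y W(2)]
        sum.insert[OF insert.hyps] ..
    moreover have "nabla Y (?t + ?s) p =
        (\<Sum>i\<in>insert i I. tscale (of_real (deriv_along A p (Y p) (f i))) (E i p) +
                     tscale (of_real (f i p)) (nabla Y (E i) p))"
      unfolding nabla_add_right[OF W(1) Y t IH(1) W(2)] IH(3) nabla_leibniz[OF W(1) fi Y Ei W(2)]
        sum.insert[OF insert.hyps] ..
    ultimately show ?case
      unfolding eq using vector_field_add[OF W(1) t IH(1)] by blast
  qed
  then show ?L ?R by blast+
qed

section \<open>Christoffel symbols\<close>

definition christoffel :: "('a, 'n) chart \<Rightarrow> complex^'n \<Rightarrow> complex^'n \<Rightarrow> complex^'n \<Rightarrow> complex^'n" where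
  "christoffel c y a b = nabla (coord_field c a) (coord_field c b) (chart_inv c y) c"

lemma component_smooth_fun:
  assumes "c \<in> A" "openin M W" "W \<subseteq> fst c" "vector_field A W X"
  shows "smooth_fun A W (\<lambda>q. X q c \<bullet> i)"
proof (rule smooth_fun_chartI[OF assms(1-3)])
  have "smooth_on (snd c ` W) (\<lambda>y. X (chart_inv c y) c)"
    using vector_field_smooth[OF assms(4,1)] assms(3) by (simp add: Int_absorb2)
  from smooth_on_linear[OF open_chart_image_sub[OF assms(1-3)] bounded_linear_inner_left this, of i]
  show "smooth_on (snd c ` W) ((\<lambda>q. X q c \<bullet> i) \<circ> chart_inv c)"
    by (simp add: comp_def)
qed

lemma vector_field_has_derivative:
  assumes "c \<in> A" "p \<in> W" "W \<subseteq> fst c" "vector_field A W X"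
  shows "((\<lambda>y. X (chart_inv c y) c) has_derivative
           frechet_derivative (\<lambda>y. X (chart_inv c y) c) (at (snd c p))) (at (snd c p))"
  by (rule differentiable_has_frechet, rule smooth_on_differentiable[OF vector_field_smooth[OF assms(4,1)]])
    (use assms in auto)

text \<open>\<open>Y\<close> is expanded by the Leibniz rule, then \<open>X\<close> by linearity
  over functions. The formula is in terms of basis sums because bilinearity of
  \<open>christoffel\<close> is itself obtained from it, by inserting coordinate fields in
  \<open>christoffel_expansion\<close>; \<open>nabla_eq\<close> is the final form.\<close>

lemma nabla_expansion:
  assumes c: "c \<in> A" and W: "openin M W" "p \<in> W" "W \<subseteq> fst c"
    and X: "vector_field A W X" and Y: "vector_field A W Y"
  shows "nabla X Y p c =
     frechet_derivative (\<lambda>y. Y (chart_inv c y) c) (at (snd c p)) (X p c) +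
     (\<Sum>i\<in>Basis. \<Sum>j\<in>Basis. ((X p c \<bullet> i) * (Y p c \<bullet> j)) *\<^sub>R christoffel c (snd c p) i j)"
proof -
  have pc: "p \<in> fst c" using W by auto
  have E: "vector_field A W (coord_field c i)" for i
    by (rule vector_field_subset[OF coord_field_vector_field[OF c] W(3)])
  have expand: "Z q = (\<Sum>i\<in>Basis. tscale (of_real (Z q c \<bullet> i)) (coord_field c i q))"
    if "vector_field A W Z" "q \<in> W" for Z q
    by (rule coord_field_expansion[OF c _ vector_field_tangent[OF that]]) (use that W in auto)
  have d: "deriv_along A p (X p) (\<lambda>q. Y q c \<bullet> j) =
      frechet_derivative (\<lambda>y. Y (chart_inv c y) c) (at (snd c p)) (X p c) \<bullet> j" for j
  proof -
    have "((\<lambda>q. Y q c \<bullet> j) \<circ> chart_inv c has_derivative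
      (\<lambda>v. frechet_derivative (\<lambda>y. Y (chart_inv c y) c) (at (snd c p)) v \<bullet> j)) (at (snd c p))"
      unfolding comp_def
      by (rule bounded_linear.has_derivative[OF bounded_linear_inner_left
            vector_field_has_derivative[OF c W(2,3) Y]])
    then show ?thesis
      using deriv_along_eq[OF c pc vector_field_tangent[OF X W(2)], of "\<lambda>q. Y q c \<bullet> j"]
        frechet_derivative_eqI by (fastforce simp: differentiable_def)
  qed
  have "nabla X Y p = nabla X (\<lambda>q. \<Sum>j\<in>Basis. tscale (of_real (Y q c \<bullet> j)) (coord_field c j q)) p"
    using expand[OF Y] by (intro nabla_cong[OF W(1,2) X _ Y]) auto
  also have "\<dots> = (\<Sum>j\<in>Basis. tscale (of_real (deriv_along A p (X p) (\<lambda>q. Y q c \<bullet> j))) (coord_field c j p) +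
                     tscale (of_real (Y p c \<bullet> j)) (nabla X (coord_field c j) p))"
    by (rule nabla_sum(2)[OF W(1,2)]) (use X E component_smooth_fun[OF c W(1,3) Y] in auto)
  finally have 1: "nabla X Y p c =
     frechet_derivative (\<lambda>y. Y (chart_inv c y) c) (at (snd c p)) (X p c) +
     (\<Sum>j\<in>Basis. (Y p c \<bullet> j) *\<^sub>R nabla X (coord_field c j) p c)"
    by (simp add: sum_fun_apply tscale_of_real d coord_field_self c pc sum.distrib euclidean_representation)
  have 2: "nabla X (coord_field c j) p c = (\<Sum>i\<in>Basis. (X p c \<bullet> i) *\<^sub>R christoffel c (snd c p) i j)" for j
  proof -
    have "nabla X (coord_field c j) p =
        nabla (\<lambda>q. \<Sum>i\<in>Basis. tscale (of_real (X q c \<bullet> i)) (coord_field c i q)) (coord_field c j) p"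
      using expand[OF X] by (intro nabla_cong[OF W(1,2) X _ E]) auto
    also have "\<dots> = (\<Sum>i\<in>Basis. tscale (of_real (X p c \<bullet> i)) (nabla (coord_field c i) (coord_field c j) p))"
      by (rule nabla_sum(1)[OF W(1,2)]) (use E component_smooth_fun[OF c W(1,3) X] in auto)
    finally show ?thesis
      by (simp add: sum_fun_apply tscale_of_real christoffel_def c pc)
  qed
  have "(\<Sum>j\<in>Basis. (Y p c \<bullet> j) *\<^sub>R nabla X (coord_field c j) p c) =
    (\<Sum>i\<in>Basis. \<Sum>j\<in>Basis. ((X p c \<bullet> i) * (Y p c \<bullet> j)) *\<^sub>R christoffel c (snd c p) i j)"
    unfolding 2 scaleR_sum_right by (subst sum.swap) (simp add: mult.commute)
  then show ?thesis using 1 by simp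
qed

lemma coord_field_derivative:
  assumes "c \<in> A" "p \<in> fst c"
  shows "frechet_derivative (\<lambda>y. coord_field c a (chart_inv c y) c) (at (snd c p)) = (\<lambda>v. 0)"
  by (rule frechet_derivative_eqI,
      rule has_derivative_transform_within_open[OF has_derivative_const chart_image_open[OF assms(1)]])
    (use assms in \<open>auto simp: coord_field_self\<close>)

lemma christoffel_expansion:
  assumes "c \<in> A" "y \<in> snd c ` fst c"
  shows "christoffel c y a b = (\<Sum>i\<in>Basis. \<Sum>j\<in>Basis. ((a \<bullet> i) * (b \<bullet> j)) *\<^sub>R christoffel c y i j)"
proof -
  obtain p where p: "y = snd c p" "p \<in> fst c" using assms by auto
  show ?thesis
    unfolding p(1)
    using nabla_expansion[OF assms(1) chart_openin[OF assms(1)] p(2) order_refl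
        coord_field_vector_field[OF assms(1), of a] coord_field_vector_field[OF assms(1), of b]] assms(1) p(2)
    by (simp add: coord_field_derivative coord_field_self christoffel_def)
qed

lemma christoffel_linear_left:
  assumes "c \<in> A" "y \<in> snd c ` fst c"
  shows "linear (\<lambda>a. christoffel c y a b)"
  by (subst christoffel_expansion[OF assms], rule linearI)
    (simp_all add: inner_add_left algebra_simps sum.distrib scaleR_sum_right)

lemma christoffel_linear_right:
  assumes "c \<in> A" "y \<in> snd c ` fst c"
  shows "linear (christoffel c y a)"
proof -
  have "christoffel c y a = (\<lambda>b. \<Sum>i\<in>Basis. \<Sum>j\<in>Basis. ((a \<bullet> i) * (b \<bullet> j)) *\<^sub>R christoffel c y i j)"
    using christoffel_expansion[OF assms] by blast
  moreover have "linear \<dots>"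
    by (rule linearI) (simp_all add: inner_add_left algebra_simps sum.distrib scaleR_sum_right)
  ultimately show ?thesis by simp
qed

lemma nabla_eq:
  assumes c: "c \<in> A" and W: "openin M W" "p \<in> W" "W \<subseteq> fst c"
    and X: "vector_field A W X" and Y: "vector_field A W Y"
  shows "nabla X Y p c =
     frechet_derivative (\<lambda>y. Y (chart_inv c y) c) (at (snd c p)) (X p c) +
     christoffel c (snd c p) (X p c) (Y p c)"
  using nabla_expansion[OF assms] christoffel_expansion[OF c, of "snd c p" "X p c" "Y p c"] W by auto

lemma christoffel_smooth:
  assumes "c \<in> A"
  shows "smooth_on (snd c ` fst c) (\<lambda>y. christoffel c y a b)"
  using vector_field_smooth[OF nabla_vector_field[OF chart_openin coord_field_vector_field
        coord_field_vector_field], OF assms assms assms assms]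
  unfolding christoffel_def by simp

lemma christoffel_differentiable:
  "c \<in> A \<Longrightarrow> y \<in> snd c ` fst c \<Longrightarrow> (\<lambda>y. christoffel c y a b) differentiable (at y)"
  using smooth_on_differentiable[OF christoffel_smooth] .

section \<open>Curvature in a chart\<close>

lemma nabla_nabla_eq:
  assumes c: "c \<in> A" and W: "openin M W" "p \<in> W" "W \<subseteq> fst c"
    and X: "vector_field A W X" and Y: "vector_field A W Y" and Z: "vector_field A W Z"
  defines "Yc \<equiv> \<lambda>y. Y (chart_inv c y) c" and "Zc \<equiv> \<lambda>y. Z (chart_inv c y) c"
    and "y0 \<equiv> snd c p" and "a \<equiv> X p c" and "b \<equiv> Y p c" and "e \<equiv> Z p c"
  shows "nabla X (nabla Y Z) p c =
    frechet_derivative (\<lambda>y. frechet_derivative Zc (at y) b) (at y0) a +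
    frechet_derivative Zc (at y0) (frechet_derivative Yc (at y0) a) +
    frechet_derivative (\<lambda>y. christoffel c y b e) (at y0) a +
    christoffel c y0 (frechet_derivative Yc (at y0) a) e +
    christoffel c y0 b (frechet_derivative Zc (at y0) a) +
    christoffel c y0 a (frechet_derivative Zc (at y0) b + christoffel c y0 b e)"
proof -
  let ?S = "snd c ` W" and ?G = "christoffel c"
  have S: "open ?S" using open_chart_image_sub[OF c W(1,3)] .
  have y0: "y0 \<in> ?S" "y0 \<in> snd c ` fst c" "chart_inv c y0 = p" "p \<in> fst c"
    using W c by (auto simp: y0_def)
  have sub: "y \<in> snd c ` fst c" if "y \<in> ?S" for y using that W by auto
  have Zs: "smooth_on ?S Zc"
    using vector_field_smooth[OF Z c] W(3) by (simp add: Zc_def Int_absorb2)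
  have dY: "(Yc has_derivative frechet_derivative Yc (at y0)) (at y0)"
    and dZ: "(Zc has_derivative frechet_derivative Zc (at y0)) (at y0)"
    unfolding Yc_def Zc_def y0_def using vector_field_has_derivative[OF c W(2,3)] Y Z by blast+
  have Y0: "Yc y0 = b" and Z0: "Zc y0 = e"
    by (simp_all add: Yc_def Zc_def y0(3) b_def e_def)
  have local: "nabla Y Z (chart_inv c y) c = frechet_derivative Zc (at y) (Yc y) + ?G y (Yc y) (Zc y)"
    if y: "y \<in> ?S" for y
  proof -
    obtain q where "q \<in> W" "y = snd c q" using y by auto
    then show ?thesis using nabla_eq[OF c W(1) _ W(3) Y Z, of q] c W(3) by (auto simp: Yc_def Zc_def)
  qed
  \<comment> \<open>Three product rules: for the differential of \<open>Zc\<close> along the moving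
    vector \<open>Yc\<close>, for the symbols in their first argument with the last one frozen, and
    for the last argument while the first one moves.\<close>
  have 1: "((\<lambda>y. frechet_derivative Zc (at y) (Yc y)) has_derivative
     (\<lambda>v. frechet_derivative (\<lambda>y. frechet_derivative Zc (at y) b) (at y0) v +
          frechet_derivative Zc (at y0) (frechet_derivative Yc (at y0) v))) (at y0)"
    using has_derivative_apply[OF S y0(1) linear_frechet_derivative
        smooth_on_differentiable[OF smooth_on_frechet[OF Zs] y0(1)] dY]
      smooth_on_differentiable[OF Zs] by (simp add: Y0)
  have 2: "((\<lambda>y. ?G y (Yc y) v) has_derivative
     (\<lambda>w. frechet_derivative (\<lambda>y. ?G y b v) (at y0) w + ?G y0 (frechet_derivative Yc (at y0) w) v)) (at y0)" for v
    using has_derivative_apply[OF S y0(1), of "\<lambda>y a. ?G y a v", OF christoffel_linear_left[OF c]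
       christoffel_differentiable[OF c] dY] sub y0 by (simp add: Y0)
  have 3: "((\<lambda>y. ?G y (Yc y) (Zc y)) has_derivative
     (\<lambda>v. frechet_derivative (\<lambda>y. ?G y (Yc y) e) (at y0) v + ?G y0 b (frechet_derivative Zc (at y0) v))) (at y0)"
    using has_derivative_apply[OF S y0(1), of "\<lambda>y. ?G y (Yc y)", OF christoffel_linear_right[OF c]
        _ dZ] sub 2 by (auto simp: Y0 Z0 differentiable_def)
  have "((\<lambda>y. nabla Y Z (chart_inv c y) c) has_derivative
     (\<lambda>v. frechet_derivative (\<lambda>y. frechet_derivative Zc (at y) b) (at y0) v +
          frechet_derivative Zc (at y0) (frechet_derivative Yc (at y0) v) +
          (frechet_derivative (\<lambda>y. ?G y b e) (at y0) v + ?G y0 (frechet_derivative Yc (at y0) v) e +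
          ?G y0 b (frechet_derivative Zc (at y0) v)))) (at y0)"
    by (rule has_derivative_transform_within_open[OF has_derivative_add[OF 1
            3[unfolded frechet_derivative_eqI[OF 2]]] S y0(1)]) (simp add: local)
  from frechet_derivative_eqI[OF this]
  show ?thesis
    using nabla_eq[OF c W X nabla_vector_field[OF W(1) Y Z]] local[OF y0(1)]
    by (simp add: y0_def[symmetric] y0 a_def[symmetric] Y0 Z0 algebra_simps)
qed

text \<open>All derivatives of the fields cancel: the second derivatives of \<open>Z\<close> by
  symmetry, the first derivatives of \<open>X\<close> and \<open>Y\<close> against the bracket term,
  and the mixed terms with first derivatives of \<open>Z\<close> in pairs. Only the values at
  \<open>p\<close> survive, so the curvature is a tensor.\<close>

lemma curvature_op_eq:
  assumes c: "c \<in> A" and W: "openin M W" "p \<in> W" "W \<subseteq> fst c"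
    and X: "vector_field A W X" and Y: "vector_field A W Y" and Z: "vector_field A W Z"
    and XY: "vector_field A W (lie_bracket A X Y)"
  shows "curvature_op A nabla X Y Z p c =
    chart_curvature (christoffel c) (snd c p) (X p c) (Y p c) (Z p c)"
proof -
  let ?y = "snd c p" and ?Z = "\<lambda>y. Z (chart_inv c y) c"
  let ?G = "christoffel c (snd c p)"
  let ?DX = "frechet_derivative (\<lambda>y. X (chart_inv c y) c) (at ?y)"
  let ?DY = "frechet_derivative (\<lambda>y. Y (chart_inv c y) c) (at ?y)"
  let ?DZ = "frechet_derivative ?Z (at ?y)"
  have pc: "p \<in> fst c" "?y \<in> snd c ` fst c" "?y \<in> snd c ` W" using W by auto
  have br: "lie_bracket A X Y p c = ?DY (X p c) - ?DX (Y p c)"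
    using c pc by (simp add: lie_bracket_def)
  have lZ: "linear ?DZ"
    using vector_field_has_derivative[OF c W(2,3) Z] has_derivative_linear by blast
  have lG: "?G (u - v) w = ?G u w - ?G v w" "?G w (u + v) = ?G w u + ?G w v" for u v w
    using linear_diff[OF christoffel_linear_left[OF c pc(2)]]
      linear_add[OF christoffel_linear_right[OF c pc(2)]] by auto
  have "smooth_on (snd c ` W) ?Z"
    using vector_field_smooth[OF Z c] W(3) by (simp add: Int_absorb2)
  then have "Ck_on 2 (snd c ` W) ?Z" by (simp add: smooth_on_def)
  note swap = frechet_derivative_swap[OF open_chart_image_sub[OF c W(1,3)] pc(3) this, of "Y p c" "X p c"]
  show ?thesis
    unfolding curvature_op_def fun_diff_def nabla_nabla_eq[OF c W X Y Z] nabla_nabla_eq[OF c W Y X Z]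
      nabla_eq[OF c W XY Z] br swap chart_curvature_def lG linear_diff[OF lZ]
    by simp
qed

lemma curvature_op_tangent:
  assumes "openin M W" "p \<in> W" "vector_field A W X" "vector_field A W Y" "vector_field A W Z"
    and "vector_field A W (lie_bracket A X Y)"
  shows "curvature_op A nabla X Y Z p \<in> tangent_space A p"
proof -
  have "nabla X (nabla Y Z) p \<in> tangent_space A p" "nabla Y (nabla X Z) p \<in> tangent_space A p"
    "nabla (lie_bracket A X Y) Z p \<in> tangent_space A p"
    by (rule vector_field_tangent[OF nabla_vector_field[OF assms(1)] assms(2)];
        (rule assms nabla_vector_field)+)+
  moreover have "curvature_op A nabla X Y Z p =
      nabla X (nabla Y Z) p - nabla Y (nabla X Z) p - nabla (lie_bracket A X Y) Z p"
    by (simp add: curvature_op_def)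
  ultimately show ?thesis by (simp only: tangent_diff)
qed

text \<open>Evaluates the \<open>THE\<close> in \<open>curvature_at\<close>. Smoothness of Lie
  brackets enters as a hypothesis on the manifold; a torsion-free connection supplies it, and it
  then serves every other connection too.\<close>

lemma curvature_at:
  assumes bracket: "\<And>W X Y. openin M W \<Longrightarrow> vector_field A W X \<Longrightarrow> vector_field A W Y \<Longrightarrow>
      vector_field A W (lie_bracket A X Y)"
    and c: "c \<in> A" "p \<in> fst c"
    and uvw: "u \<in> tangent_space A p" "v \<in> tangent_space A p" "w \<in> tangent_space A p"
  shows "curvature_at M A nabla p u v w \<in> tangent_space A p"
    and "curvature_at M A nabla p u v w c =
      chart_curvature (christoffel c) (snd c p) (u c) (v c) (w c)"
proof -
  have val: "curvature_op A nabla X Y Z p \<in> tangent_space A p \<and>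
      curvature_op A nabla X Y Z p c = chart_curvature (christoffel c) (snd c p) (u c) (v c) (w c)"
    if XYZ: "extends_vector M A p u X" "extends_vector M A p v Y" "extends_vector M A p w Z" for X Y Z
  proof -
    obtain W1 W2 W3 where W: "openin M W1" "p \<in> W1" "vector_field A W1 X" "openin M W2" "p \<in> W2"
      "vector_field A W2 Y" "openin M W3" "p \<in> W3" "vector_field A W3 Z"
      and val: "X p = u" "Y p = v" "Z p = w"
      using XYZ unfolding extends_vector_def by metis
    define W where "W = W1 \<inter> W2 \<inter> W3 \<inter> fst c"
    have WW: "openin M W" "p \<in> W" "W \<subseteq> fst c"
      unfolding W_def using W c chart_openin[OF c(1)] by (auto intro!: openin_Int)
    have vf: "vector_field A W X" "vector_field A W Y" "vector_field A W Z"
      by (rule vector_field_subset[OF W(3)] vector_field_subset[OF W(6)] vector_field_subset[OF W(9)];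
          auto simp: W_def)+
    show ?thesis
      using curvature_op_tangent[OF WW(1,2) vf bracket[OF WW(1) vf(1,2)]]
        curvature_op_eq[OF c(1) WW vf bracket[OF WW(1) vf(1,2)]] val by simp
  qed
  \<comment> \<open>Coordinate fields show that extensions exist; without one the condition under
    \<open>THE\<close> would hold vacuously for every value.\<close>
  have ext: "extends_vector M A p z (coord_field c (z c))" if "z \<in> tangent_space A p" for z
    unfolding extends_vector_def
    using chart_openin[OF c(1)] c coord_field_vector_field[OF c(1)]
      tangent_eqI[OF coord_field_tangent[OF c] that c] coord_field_self[OF c] by blast
  let ?r = "curvature_op A nabla (coord_field c (u c)) (coord_field c (v c)) (coord_field c (w c)) p"
  have r: "curvature_at M A nabla p u v w = ?r"
    unfolding curvature_at_def
  proof (rule the_equality)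
    show "\<forall>X Y Z. extends_vector M A p u X \<and> extends_vector M A p v Y \<and> extends_vector M A p w Z
        \<longrightarrow> curvature_op A nabla X Y Z p = ?r"
      using val val[OF ext ext ext, OF uvw] tangent_eqI[OF _ _ c] by metis
  qed (use ext uvw in metis)
  show "curvature_at M A nabla p u v w \<in> tangent_space A p"
    "curvature_at M A nabla p u v w c = chart_curvature (christoffel c) (snd c p) (u c) (v c) (w c)"
    using val[OF ext ext ext, OF uvw] by (simp_all add: r)
qed

end

section \<open>The Chern connection on the real tangent bundle\<close>

lemma tscale_tscale: "tscale a (tscale b u) = tscale (a * b) u"
  by (simp add: fun_eq_iff tscale_apply)

lemma tscale_one: "tscale 1 u = u"
  by (simp add: fun_eq_iff tscale_apply)

lemma tscale_add_left: "tscale (a + b) u = tscale a u + tscale b u"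
  by (simp add: fun_eq_iff tscale_apply vec_eq_iff algebra_simps)

lemma tscale_add_right: "tscale a (u + v) = tscale a u + tscale a v"
  by (simp add: fun_eq_iff tscale_apply vec_eq_iff algebra_simps)

lemma tscale_zero_left: "tscale 0 u = 0"
  by (simp add: fun_eq_iff tscale_apply)

lemma to10_eq: "to10 u = (tscale (1/2) u, tscale (- (\<i> / 2)) u)"
  by (simp add: to10_def cscale_def prod_eq_iff fun_eq_iff tscale_apply cJ_apply vec_eq_iff)

text \<open>Together with \<open>T10_to10_dz\<close> this makes \<open>dz\<close> the inverse of
  \<open>to10\<close>, so that the transported connection is \<open>D\<close> conjugated by
  \<open>to10\<close> and the \<open>THE\<close> in its definition can be evaluated.\<close>

lemma dz_to10: "dz (to10 u) = u"
  by (simp add: to10_eq dz_def tscale_tscale tscale_add_left[symmetric] tscale_one)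

lemma dz_add: "dz (s + t) = dz s + dz t"
  by (simp add: dz_def fun_eq_iff tscale_apply vec_eq_iff algebra_simps)

lemma dz_cscale: "dz (cscale z s) = tscale z (dz s)"
  by (simp add: dz_def cscale_def fun_eq_iff tscale_apply vec_eq_iff complex_eq_iff algebra_simps)

lemma to10_add: "to10 (u + v) = to10 u + to10 v"
  by (simp add: to10_eq tscale_add_right)

lemma to10_tscale: "to10 (tscale z u) = cscale z (to10 u)"
  by (simp add: to10_eq cscale_def fun_eq_iff tscale_apply vec_eq_iff complex_eq_iff field_simps)

lemma T10_to10_dz:
  assumes "s \<in> T10 A p"
  shows "to10 (dz s) = s"
proof -
  have "cJ (fst s) = - snd s"
    using assms by (simp add: T10_def cscale_def fun_eq_iff tscale_apply)
  then have s: "snd s = tscale (- \<i>) (fst s)"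
    by (simp add: cJ_def fun_eq_iff tscale_apply vec_eq_iff)
  show ?thesis
    by (simp add: to10_eq dz_def s prod_eq_iff fun_eq_iff tscale_apply vec_eq_iff)
qed

context cmanifold
begin

lemma dz_tangent: "s \<in> T10 A p \<Longrightarrow> dz s \<in> tangent_space A p"
  unfolding dz_def by (intro tangent_add tangent_tscale) (auto simp: T10_def)

lemma to10_T10:
  assumes "u \<in> tangent_space A p"
  shows "to10 u \<in> T10 A p"
  using tangent_tscale[OF assms]
  by (simp add: T10_def to10_eq cJ_def cscale_def tscale_tscale tscale_one)
     (simp add: fun_eq_iff tscale_apply)

lemma section10_to10:
  assumes "openin M W" "vector_field A W Y"
  shows "section10 A W (\<lambda>q. to10 (Y q))"
  using to10_T10[OF vector_field_tangent[OF assms(2)]] vector_field_tscale[OF assms]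
  by (simp add: section10_def) (simp add: to10_eq)

lemma vector_field_dz:
  assumes "openin M W" "section10 A W s"
  shows "vector_field A W (\<lambda>q. dz (s q))"
proof -
  have "(\<lambda>q. dz (s q)) = (\<lambda>q. fst (s q)) + (\<lambda>q. tscale \<i> (snd (s q)))"
    by (simp add: dz_def fun_eq_iff)
  then show ?thesis
    using vector_field_add[OF assms(1) _ vector_field_tscale[OF assms(1)]] assms(2)
    by (metis section10_def)
qed

lemma transport_eq:
  assumes "D X (\<lambda>q. to10 (Y q)) p \<in> T10 A p"
  shows "transport_to_real A D X Y p = dz (D X (\<lambda>q. to10 (Y q)) p)"
  unfolding transport_to_real_def
proof (rule the_equality)
  fix w assume "w \<in> tangent_space A p \<and> to10 w = D X (\<lambda>q. to10 (Y q)) p"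
  then show "w = dz (D X (\<lambda>q. to10 (Y q)) p)" using dz_to10[of w] by auto
qed (use T10_to10_dz[OF assms] dz_tangent[OF assms] in blast)

lemma smooth_fun_const: "smooth_fun A W (\<lambda>q. z)"
  by (simp add: smooth_fun_def comp_def smooth_on_const)

lemma deriv_along_const:
  assumes "p \<in> topspace M" "u \<in> tangent_space A p"
  shows "deriv_along A p u (\<lambda>q. z) = 0"
proof -
  obtain c where c: "c \<in> A" "p \<in> fst c" using chart_exists[OF assms(1)] by auto
  show ?thesis using deriv_along_eq[OF c assms(2), of "\<lambda>q. z"] by (simp add: comp_def)
qed

lemma deriv_along_linear:
  fixes f :: "'a \<Rightarrow> 'b::real_normed_vector"
  assumes "c \<in> A" "p \<in> fst c" "u \<in> tangent_space A p" "(f \<circ> chart_inv c) differentiable (at (snd c p))"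
    and "bounded_linear L"
  shows "deriv_along A p u (\<lambda>q. L (f q)) = L (deriv_along A p u f)"
proof -
  have "((\<lambda>q. L (f q)) \<circ> chart_inv c has_derivative
      (\<lambda>v. L (frechet_derivative (f \<circ> chart_inv c) (at (snd c p)) v))) (at (snd c p))"
    using bounded_linear.has_derivative[OF assms(5) differentiable_has_frechet[OF assms(4)]]
    by (simp add: comp_def)
  from frechet_derivative_eqI[OF this] this show ?thesis
    using deriv_along_eq[OF assms(1-3), of "\<lambda>q. L (f q)"] deriv_along_eq[OF assms(1-4)]
    by (auto simp: differentiable_def)
qed

lemma smooth_fun_linear:
  assumes "openin M W" "bounded_linear L" "smooth_fun A W f"
  shows "smooth_fun A W (\<lambda>q. L (f q))"
  unfolding smooth_fun_def
proof
  fix c assume c: "c \<in> A"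
  show "smooth_on (snd c ` (W \<inter> fst c)) ((\<lambda>q. L (f q)) \<circ> chart_inv c)"
    using smooth_on_linear[OF open_chart_image[OF c assms(1)] assms(2) smooth_fun_smooth[OF assms(3) c]]
    by (simp add: comp_def)
qed

lemma smooth_fun_differentiable:
  "smooth_fun A W f \<Longrightarrow> c \<in> A \<Longrightarrow> p \<in> W \<Longrightarrow> p \<in> fst c \<Longrightarrow> (f \<circ> chart_inv c) differentiable (at (snd c p))"
  by (rule smooth_on_differentiable[OF smooth_fun_smooth]) auto

section \<open>Transport of a connection to the real tangent bundle\<close>

context
  fixes D :: "('a \<Rightarrow> ('a, 'n) tvec) \<Rightarrow> ('a \<Rightarrow> ('a, 'n) cvec) \<Rightarrow> 'a \<Rightarrow> ('a, 'n) cvec"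
  assumes D: "connection10 M A D"
begin

lemma D_section10:
  "openin M W \<Longrightarrow> vector_field A W X \<Longrightarrow> section10 A W s \<Longrightarrow> section10 A W (D X s)"
  using D[unfolded connection10_def, rule_format, of W,
    THEN conjunct1, rule_format, of X s] by blast

lemma D_add_left:
  "openin M W \<Longrightarrow> vector_field A W X \<Longrightarrow> vector_field A W X' \<Longrightarrow> section10 A W s \<Longrightarrow> p \<in> W \<Longrightarrow>
     D (X + X') s p = D X s p + D X' s p"
  using D[unfolded connection10_def, rule_format, of W,
    THEN conjunct2, THEN conjunct1, rule_format, of X X' s p] by blast

lemma D_scale_left:
  fixes f :: "'a \<Rightarrow> real"
  shows "openin M W \<Longrightarrow> smooth_fun A W f \<Longrightarrow> vector_field A W X \<Longrightarrow> section10 A W s \<Longrightarrow> p \<in> W \<Longrightarrow>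
     D (\<lambda>q. tscale (of_real (f q)) (X q)) s p = cscale (of_real (f p)) (D X s p)"
  using D[unfolded connection10_def, rule_format, of W,
    THEN conjunct2, THEN conjunct2, THEN conjunct1, rule_format, of f X s p] by blast

lemma D_add_right:
  "openin M W \<Longrightarrow> vector_field A W X \<Longrightarrow> section10 A W s \<Longrightarrow> section10 A W t \<Longrightarrow> p \<in> W \<Longrightarrow>
     D X (s + t) p = D X s p + D X t p"
  using D[unfolded connection10_def, rule_format, of W,
    THEN conjunct2, THEN conjunct2, THEN conjunct2, THEN conjunct1, rule_format, of X s t p] by blast

lemma D_leibniz:
  fixes f :: "'a \<Rightarrow> complex"
  shows "openin M W \<Longrightarrow> smooth_fun A W f \<Longrightarrow> vector_field A W X \<Longrightarrow> section10 A W s \<Longrightarrow> p \<in> W \<Longrightarrow>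
     D X (\<lambda>q. cscale (f q) (s q)) p =
     cscale (deriv_along A p (X p) f) (s p) + cscale (f p) (D X s p)"
  using D[unfolded connection10_def, rule_format, of W,
    THEN conjunct2, THEN conjunct2, THEN conjunct2, THEN conjunct2, rule_format, of f X s p] by blast

lemma transport_dz:
  assumes "openin M W" "vector_field A W X" "vector_field A W Y" "p \<in> W"
  shows "transport_to_real A D X Y p = dz (D X (\<lambda>q. to10 (Y q)) p)"
  using D_section10[OF assms(1,2) section10_to10[OF assms(1,3)]] assms(4)
  by (intro transport_eq) (simp add: section10_def)

text \<open>The Leibniz rule of \<open>D\<close> for complex functions survives the transport, since
  \<open>to10\<close> is complex linear. Real \<open>f\<close> gives the axiom of an affine
  connection; constant complex \<open>f\<close> gives \<open>transport_tscale\<close>.\<close>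

lemma transport_leibniz:
  fixes f :: "'a \<Rightarrow> complex"
  assumes W: "openin M W" and X: "vector_field A W X" and Y: "vector_field A W Y" and p: "p \<in> W"
    and f: "smooth_fun A W f" and fY: "vector_field A W (\<lambda>q. tscale (f q) (Y q))"
  shows "transport_to_real A D X (\<lambda>q. tscale (f q) (Y q)) p =
    tscale (deriv_along A p (X p) f) (Y p) + tscale (f p) (transport_to_real A D X Y p)"
  unfolding transport_dz[OF W X fY p] transport_dz[OF W X Y p] to10_tscale
    D_leibniz[OF W f X section10_to10[OF W Y] p] dz_add dz_cscale dz_to10 ..

lemma transport_affine: "affine_connection M A (transport_to_real A D)"
  unfolding affine_connection_def
proof (intro allI impI conjI ballI; (elim conjE)?)
  fix W X Y assume W: "openin M W" and X: "vector_field A W X" and Y: "vector_field A W Y"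
  note s = section10_to10[OF W Y]
  show "vector_field A W (transport_to_real A D X Y)"
    by (rule vector_field_cong[OF W _ vector_field_dz[OF W D_section10[OF W X s]]])
      (simp add: transport_dz[OF W X Y])
next
  fix W X X' Y p assume W: "openin M W" and X: "vector_field A W X" and X': "vector_field A W X'"
    and Y: "vector_field A W Y" and p: "p \<in> W"
  show "transport_to_real A D (X + X') Y p = transport_to_real A D X Y p + transport_to_real A D X' Y p"
    unfolding transport_dz[OF W vector_field_add[OF W X X'] Y p] transport_dz[OF W X Y p]
      transport_dz[OF W X' Y p] D_add_left[OF W X X' section10_to10[OF W Y] p] dz_add ..
next
  fix W X Y p and f :: "'a \<Rightarrow> real"
  assume W: "openin M W" and f: "smooth_fun A W f" and X: "vector_field A W X"
    and Y: "vector_field A W Y" and p: "p \<in> W"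
  show "transport_to_real A D (\<lambda>q. tscale (of_real (f q)) (X q)) Y p =
      tscale (of_real (f p)) (transport_to_real A D X Y p)"
    unfolding transport_dz[OF W vector_field_scale_fun[OF W f X] Y p] transport_dz[OF W X Y p]
      D_scale_left[OF W f X section10_to10[OF W Y] p] dz_cscale ..
next
  fix W X Y Y' p assume W: "openin M W" and X: "vector_field A W X" and Y: "vector_field A W Y"
    and Y': "vector_field A W Y'" and p: "p \<in> W"
  have "(\<lambda>q. to10 ((Y + Y') q)) = (\<lambda>q. to10 (Y q)) + (\<lambda>q. to10 (Y' q))"
    by (rule ext) (simp only: plus_fun_apply to10_add)
  then show "transport_to_real A D X (Y + Y') p = transport_to_real A D X Y p + transport_to_real A D X Y' p"
    unfolding transport_dz[OF W X vector_field_add[OF W Y Y'] p] transport_dz[OF W X Y p]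
      transport_dz[OF W X Y' p]
    by (simp only: D_add_right[OF W X section10_to10[OF W Y] section10_to10[OF W Y'] p] dz_add)
next
  fix W X Y p and f :: "'a \<Rightarrow> real"
  assume W: "openin M W" and f: "smooth_fun A W f" and X: "vector_field A W X"
    and Y: "vector_field A W Y" and p: "p \<in> W"
  have "p \<in> topspace M" using W p openin_subset by auto
  from chart_exists[OF this] obtain c where c: "c \<in> A" "p \<in> fst c" by auto
  have "deriv_along A p (X p) (\<lambda>q. complex_of_real (f q)) = of_real (deriv_along A p (X p) f)"
    by (rule deriv_along_linear[OF c vector_field_tangent[OF X p] smooth_fun_differentiable[OF f c(1) p c(2)]
          bounded_linear_of_real])
  then show "transport_to_real A D X (\<lambda>q. tscale (of_real (f q)) (Y q)) p =
      tscale (of_real (deriv_along A p (X p) f)) (Y p) + tscale (of_real (f p)) (transport_to_real A D X Y p)"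
    using transport_leibniz[OF W X Y p smooth_fun_linear[OF W bounded_linear_of_real f]
        vector_field_scale_fun[OF W f Y]] by simp
qed

text \<open>For \<open>z\<close> = \<i> this says that J is parallel for the transported
  connection.\<close>

lemma transport_tscale:
  assumes "openin M W" "vector_field A W X" "vector_field A W Y" "p \<in> W"
  shows "transport_to_real A D X (\<lambda>q. tscale z (Y q)) p = tscale z (transport_to_real A D X Y p)"
proof -
  have "p \<in> topspace M" using assms openin_subset by auto
  from deriv_along_const[OF this vector_field_tangent[OF assms(2,4)], of z] show ?thesis
    using transport_leibniz[OF assms smooth_fun_const vector_field_tscale[OF assms(1,3)], of z]
    by (simp add: tscale_zero_left)
qed

end

lemma coord_field_smult: "coord_field c (z *s a) = (\<lambda>q. tscale z (coord_field c a q))"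
  by (auto simp: coord_field_def fun_eq_iff tscale_apply transition_deriv_smult)

section \<open>The metric in a chart\<close>

lemma herm_eq:
  assumes "hermitian_metric A h" "c \<in> A" "p \<in> fst c" "u \<in> tangent_space A p" "v \<in> tangent_space A p"
  shows "herm A h p u v = herm_form (h c p) (u c) (v c)"
  unfolding herm_def
proof (rule the_equality)
  show "\<forall>d\<in>A. p \<in> fst d \<longrightarrow> herm_form (h d p) (u d) (v d) = herm_form (h c p) (u c) (v c)"
    using assms unfolding hermitian_metric_def by blast
qed (use assms in blast)

definition chart_metric :: "('a, 'n) metric_coeffs \<Rightarrow> ('a, 'n) chart \<Rightarrow> complex^'n \<Rightarrow> complex^'n \<Rightarrow> complex^'n \<Rightarrow> real" where
  "chart_metric h c y a b = Re (herm_form (h c (chart_inv c y)) a b)"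

lemma riem_g_eq:
  assumes "hermitian_metric A h" "c \<in> A" "p \<in> fst c" "u \<in> tangent_space A p" "v \<in> tangent_space A p"
  shows "riem_g A h p u v = chart_metric h c (snd c p) (u c) (v c)"
  using assms by (simp add: riem_g_def herm_eq[OF assms] chart_metric_def)

lemma herm_form_differentiable:
  assumes "hermitian_metric A h" "c \<in> A" "y \<in> snd c ` fst c"
  shows "(\<lambda>y. herm_form (h c (chart_inv c y)) a b) differentiable (at y)"
proof -
  have "linear (\<lambda>H. herm_form H a b)"
    by (rule linearI) (simp_all add: herm_form_def algebra_simps sum.distrib scaleR_sum_right)
  then have "bounded_linear (\<lambda>H. herm_form H a b)"
    by (simp add: linear_conv_bounded_linear)
  moreover have "(h c \<circ> chart_inv c) differentiable (at y)"
    by (rule smooth_on_differentiable[OF _ assms(3)])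
      (use assms(1,2) in \<open>simp add: hermitian_metric_def\<close>)
  ultimately show ?thesis
    using bounded_linear.has_derivative differentiable_has_frechet
    unfolding differentiable_def comp_def by blast
qed

lemma chart_metric_differentiable:
  assumes "hermitian_metric A h" "c \<in> A" "y \<in> snd c ` fst c"
  shows "(\<lambda>y. chart_metric h c y a b) differentiable (at y)"
  using bounded_linear.has_derivative[OF bounded_linear_Re differentiable_has_frechet[OF
      herm_form_differentiable[OF assms]]]
  unfolding chart_metric_def differentiable_def by blast

text \<open>Links three forms of one derivative: of the coefficients of g in the chart, of g on the
  manifold, and the real part of the derivative of h. The last is how compatibility of
  \<open>D\<close> with h, a complex identity, yields compatibility of the transported connection
  with g.\<close>

lemma deriv_along_riem_g:
  assumes h: "hermitian_metric A h" and c: "c \<in> A" "p \<in> fst c" and u: "u \<in> tangent_space A p"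
  shows "deriv_along A p u (\<lambda>q. riem_g A h q (coord_field c a q) (coord_field c b q)) =
    frechet_derivative (\<lambda>y. chart_metric h c y a b) (at (snd c p)) (u c)" (is ?R)
    and "deriv_along A p u (\<lambda>q. riem_g A h q (coord_field c a q) (coord_field c b q)) =
    Re (deriv_along A p u (\<lambda>q. herm A h q (coord_field c a q) (coord_field c b q)))" (is ?C)
proof -
  have pc: "snd c p \<in> snd c ` fst c" using c by auto
  have near: "herm A h (chart_inv c y) (coord_field c a (chart_inv c y)) (coord_field c b (chart_inv c y)) =
      herm_form (h c (chart_inv c y)) a b" if "y \<in> snd c ` fst c" for y
    using that c by (auto simp: herm_eq[OF h c(1) _ coord_field_tangent coord_field_tangent] coord_field_self)
  have 1: "((\<lambda>q. herm A h q (coord_field c a q) (coord_field c b q)) \<circ> chart_inv c) differentiable (at (snd c p))"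
    by (rule differentiable_transform_open[OF herm_form_differentiable[OF h c(1) pc] chart_image_open[OF c(1)] pc])
      (simp add: near)
  show ?C
    unfolding riem_g_def by (rule deriv_along_linear[OF c u 1 bounded_linear_Re])
  have 2: "((\<lambda>q. riem_g A h q (coord_field c a q) (coord_field c b q)) \<circ> chart_inv c has_derivative
      frechet_derivative (\<lambda>y. chart_metric h c y a b) (at (snd c p))) (at (snd c p))"
    by (rule has_derivative_transform_within_open[OF differentiable_has_frechet[OF
          chart_metric_differentiable[OF h c(1) pc]] chart_image_open[OF c(1)] pc])
      (simp add: near riem_g_def chart_metric_def)
  show ?R
    using deriv_along_eq[OF c u, of "\<lambda>q. riem_g A h q (coord_field c a q) (coord_field c b q)"] 2
      frechet_derivative_eqI[OF 2] by (auto simp: differentiable_def)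
qed

end

section \<open>The torsion of the Chern connection\<close>

lemma i_smult_i_smult: "\<i> *s (\<i> *s a) = - (a :: complex^'n)"
  by (simp add: vec_eq_iff)

text \<open>A Hermitian metric \<open>g\<close> on a coordinate domain \<open>S\<close>, with the Christoffel symbols \<open>G\<close> of its
  Levi-Civita connection and \<open>H\<close> of its Chern connection.\<close>

locale hermitian_chart =
  fixes S :: "(complex^'n) set"
    and g :: "complex^'n \<Rightarrow> complex^'n \<Rightarrow> complex^'n \<Rightarrow> real"
    and G H :: "complex^'n \<Rightarrow> complex^'n \<Rightarrow> complex^'n \<Rightarrow> complex^'n"
  assumes open_S: "open S"
    and g_linear: "y \<in> S \<Longrightarrow> linear (\<lambda>a. g y a b)"
    and g_sym: "y \<in> S \<Longrightarrow> g y a b = g y b a"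
    and g_pos: "y \<in> S \<Longrightarrow> a \<noteq> 0 \<Longrightarrow> 0 < g y a a"
    and g_J: "y \<in> S \<Longrightarrow> g y (\<i> *s a) (\<i> *s b) = g y a b"
    and g_diff: "y \<in> S \<Longrightarrow> (\<lambda>y. g y a b) differentiable (at y)"
    and G_linear: "y \<in> S \<Longrightarrow> linear (G y a)"
    and G_sym: "y \<in> S \<Longrightarrow> G y a b = G y b a"
    and G_diff: "y \<in> S \<Longrightarrow> (\<lambda>y. G y a b) differentiable (at y)"
    and G_metric: "y \<in> S \<Longrightarrow> frechet_derivative (\<lambda>y. g y b e) (at y) a = g y (G y a b) e + g y b (G y a e)"
    and H_linear: "y \<in> S \<Longrightarrow> linear (H y a)"
    and H_linear_left: "y \<in> S \<Longrightarrow> linear (\<lambda>a. H y a b)"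
    and H_J: "y \<in> S \<Longrightarrow> H y a (\<i> *s b) = \<i> *s H y a b"
    and H_J_left: "y \<in> S \<Longrightarrow> H y (\<i> *s a) b = \<i> *s H y a b"
    and H_diff: "y \<in> S \<Longrightarrow> (\<lambda>y. H y a b) differentiable (at y)"
    and H_metric: "y \<in> S \<Longrightarrow> frechet_derivative (\<lambda>y. g y b e) (at y) a = g y (H y a b) e + g y b (H y a e)"
begin

definition contorsion where "contorsion y a b = H y a b - G y a b"
definition torsion where "torsion y a b = H y a b - H y b a"

section \<open>Algebra of contorsion and torsion\<close>

lemma g_simps:
  assumes "y \<in> S"
  shows "g y (a + b) e = g y a e + g y b e" "g y (a - b) e = g y a e - g y b e"
    "g y (- a) e = - g y a e" "g y 0 e = 0"
    "g y e (a + b) = g y e a + g y e b" "g y e (a - b) = g y e a - g y e b"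
    "g y e (- a) = - g y e a" "g y e 0 = 0"
  using linear_add[OF g_linear[OF assms]] linear_diff[OF g_linear[OF assms]]
    linear_neg[OF g_linear[OF assms]] linear_0[OF g_linear[OF assms]] g_sym[OF assms, of e]
  by auto

lemma g_J_skew:
  assumes "y \<in> S"
  shows "g y (\<i> *s a) b = - g y a (\<i> *s b)"
  using g_J[OF assms, of a "\<i> *s b"] by (simp add: i_smult_i_smult g_simps[OF assms])

lemma g_eqI:
  assumes "y \<in> S" "\<And>x. g y a x = g y b x"
  shows "a = b"
  using g_pos[OF assms(1), of "a - b"] assms(2)[of "a - b"] g_simps(2)[OF assms(1), of a b "a - b"]
  by auto

lemma contorsion_skew:
  assumes "y \<in> S"
  shows "g y (contorsion y a b) e = - g y b (contorsion y a e)"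
  using G_metric[OF assms, of b e a] H_metric[OF assms, of b e a]
  by (simp add: contorsion_def g_simps[OF assms])

lemma contorsion_diff:
  assumes "y \<in> S"
  shows "contorsion y a b = contorsion y b a + torsion y a b"
  using G_sym[OF assms, of a b] by (simp add: contorsion_def torsion_def)

lemma torsion_J:
  assumes "y \<in> S"
  shows "torsion y (\<i> *s a) b = \<i> *s torsion y a b" "torsion y a (\<i> *s b) = \<i> *s torsion y a b"
  using H_J[OF assms] H_J_left[OF assms] by (simp_all add: torsion_def vec_eq_iff right_diff_distrib)

lemma torsion_swap: "torsion y a b = - torsion y b a"
  by (simp add: torsion_def)

lemma torsion_self: "torsion y a a = 0"
  by (simp add: torsion_def)

text \<open>Skewness moves \<theta>(u, \<cdot>) to the other side, and exchanging its arguments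
  costs T(u, w); the remaining g(u, \<theta>(w, u)) is 0, again by skewness.\<close>

lemma contorsion_self:
  assumes "y \<in> S"
  shows "g y (contorsion y u u) w = g y (torsion y w u) u"
proof -
  have "g y (contorsion y w u) u = 0"
    using contorsion_skew[OF assms, of w u u] g_sym[OF assms, of u "contorsion y w u"] by simp
  then show ?thesis
    using contorsion_skew[OF assms, of u u w] contorsion_diff[OF assms, of u w] torsion_swap[of y u w]
      g_sym[OF assms, of u]
    by (simp add: g_simps[OF assms])
qed

lemma contorsion_J_J:
  assumes "y \<in> S"
  shows "contorsion y (\<i> *s u) (\<i> *s u) = contorsion y u u"
  by (rule g_eqI[OF assms]) (simp add: contorsion_self[OF assms] torsion_J[OF assms] g_J[OF assms])

text \<open>The two vectors agree because T(u, Ju) = J T(u, u) = 0. Expanding both against any w by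
  skewness, and exchanging arguments at the cost of torsion, gives opposite numbers.\<close>

lemma contorsion_J:
  assumes "y \<in> S"
  shows "contorsion y u (\<i> *s u) = 0" "contorsion y (\<i> *s u) u = 0"
proof -
  let ?v = "\<i> *s u"
  have eq: "contorsion y u ?v = contorsion y ?v u"
    using contorsion_diff[OF assms, of u ?v] by (simp add: torsion_J[OF assms] torsion_self)
  have "g y (contorsion y u ?v) w = 0" for w
  proof -
    have 1: "g y (contorsion y u ?v) w = - g y ?v (contorsion y w u) - g y ?v (torsion y u w)"
      using contorsion_skew[OF assms, of u ?v w] contorsion_diff[OF assms, of u w]
      by (simp add: g_simps[OF assms])
    have 2: "g y (contorsion y ?v u) w = - g y u (contorsion y w ?v) - g y u (\<i> *s torsion y u w)"
      using contorsion_skew[OF assms, of ?v u w] contorsion_diff[OF assms, of ?v w]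
      by (simp add: g_simps[OF assms] torsion_J[OF assms])
    have 3: "g y u (contorsion y w ?v) = - g y ?v (contorsion y w u)"
      using contorsion_skew[OF assms, of w u ?v] g_sym[OF assms] by (metis minus_minus)
    show ?thesis
      using 1 2 3 eq g_J_skew[OF assms, of u "torsion y u w"] by simp
  qed
  then show "contorsion y u ?v = 0"
    by (intro g_eqI[OF assms]) (simp add: g_simps[OF assms])
  then show "contorsion y ?v u = 0" using eq by simp
qed

section \<open>Comparison of the curvatures on holomorphic planes\<close>

lemma holomorphic_curvature_difference:
  fixes u :: "complex^'n"
  assumes y: "y \<in> S"
  defines "v \<equiv> \<i> *s u"
  shows "g y (chart_curvature H y v u u) v - g y (chart_curvature G y v u u) v =
    g y (contorsion y u u) (contorsion y u u)"
proof -
  define a where "a = (\<lambda>y. contorsion y u u)"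
  define t where "t = H y u u"
  define da where "da = frechet_derivative a (at y) v"
  have a_diff: "(a has_derivative (\<lambda>w. frechet_derivative (\<lambda>y. H y u u) (at y) w -
      frechet_derivative (\<lambda>y. G y u u) (at y) w)) (at y)"
    unfolding a_def contorsion_def
    by (intro has_derivative_diff differentiable_has_frechet H_diff G_diff y)
  have da_eq: "da = frechet_derivative (\<lambda>y. H y u u) (at y) v - frechet_derivative (\<lambda>y. G y u u) (at y) v"
    by (simp add: da_def frechet_derivative_eqI[OF a_diff])
  \<comment> \<open>Proved on all of \<open>S\<close>, because it is differentiated next; it makes
    the derivatives of the symbols in direction \<open>u\<close> cancel between the two
    curvatures.\<close>
  have G_v_u: "G z v u = H z v u" if "z \<in> S" for z
    using contorsion_J(2)[OF that, of u] by (simp add: contorsion_def v_def)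
  have d_v_u: "frechet_derivative (\<lambda>z. G z v u) (at y) = frechet_derivative (\<lambda>z. H z v u) (at y)"
    by (rule frechet_derivative_transform_within_open[OF G_diff[OF y] open_S y G_v_u])
  have H_vals: "H y v u = \<i> *s t" "H y u v = \<i> *s t" "H y v v = - t"
    using H_J[OF y] H_J_left[OF y] by (simp_all add: v_def t_def i_smult_i_smult)
  have G_u_u: "G y u u = t - a y" by (simp add: a_def t_def contorsion_def)
  have G_v_v: "G y v v = - t - a y"
    using contorsion_J_J[OF y, of u] H_vals(3) by (simp add: a_def contorsion_def v_def algebra_simps)
  have orth: "g z (a z) v = 0" if "z \<in> S" for z
    using contorsion_self[OF that, of u v]
    by (simp add: a_def v_def torsion_J[OF that] torsion_self g_simps[OF that])
  have "((\<lambda>z. g z (a z) v) has_derivative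
     (\<lambda>w. frechet_derivative (\<lambda>z. g z (a y) v) (at y) w + g y (frechet_derivative a (at y) w) v)) (at y)"
    by (rule has_derivative_apply[OF open_S y, of "\<lambda>z b. g z b v", OF g_linear g_diff[OF y]])
      (use a_diff frechet_derivative_eqI[OF a_diff] in auto)
  moreover have "((\<lambda>z. g z (a z) v) has_derivative (\<lambda>w. 0)) (at y)"
    by (rule has_derivative_transform_within_open[OF has_derivative_const open_S y]) (simp add: orth)
  ultimately have "frechet_derivative (\<lambda>z. g z (a y) v) (at y) v + g y da v = 0"
    unfolding da_def by (rule fun_cong[OF has_derivative_unique])
  \<comment> \<open>Metric compatibility of \<open>G\<close> replaces the derivative of
    \<open>g\<close>. The value of \<open>G y v v\<close> contains - a y, and this is where the
    square of the contorsion appears.\<close>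
  then have 1: "g y da v = - g y (G y v (a y)) v + g y (a y) t + g y (a y) (a y)"
    using G_metric[OF y, of "a y" v v] by (simp add: G_v_v g_simps[OF y])
  \<comment> \<open>Skewness puts the contorsion on the pair \<open>v\<close>, \<open>v\<close>,
    where it is again \<open>a y\<close>; in \<open>3\<close> it lands on \<open>u\<close>,
    \<open>v\<close>, where it is 0.\<close>
  have 2: "g y (H y v t) v - g y (G y v t) v = - g y (a y) t"
    using contorsion_skew[OF y, of v t v] contorsion_J_J[OF y, of u, folded v_def] g_sym[OF y, of t]
    by (simp add: a_def) (simp add: contorsion_def g_simps[OF y])
  have 3: "g y (H y u (\<i> *s t)) v - g y (G y u (\<i> *s t)) v = 0"
    using contorsion_skew[OF y, of u "\<i> *s t" v] contorsion_J(1)[OF y, of u, folded v_def]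
    by (simp add: contorsion_def g_simps[OF y])
  have "g y (chart_curvature H y v u u) v - g y (chart_curvature G y v u u) v =
    g y da v + g y (H y v t) v - g y (G y v (t - a y)) v
      - (g y (H y u (\<i> *s t)) v - g y (G y u (\<i> *s t)) v)"
    unfolding chart_curvature_def d_v_u G_v_u[OF y] G_u_u H_vals t_def[symmetric] da_eq
    by (simp add: g_simps[OF y])
  also have "\<dots> = g y (a y) (a y)"
    using 1 2 3 by (simp add: linear_diff[OF G_linear[OF y]] g_simps[OF y])
  finally show ?thesis by (simp add: a_def)
qed

lemma H_curvature_J:
  assumes y: "y \<in> S"
  shows "chart_curvature H y a b (\<i> *s e) = \<i> *s chart_curvature H y a b e"
proof -
  have "frechet_derivative (\<lambda>z. H z b (\<i> *s e)) (at y) a = \<i> *s frechet_derivative (\<lambda>z. H z b e) (at y) a" for a b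
  proof -
    have "((\<lambda>z. H z b (\<i> *s e)) has_derivative (\<lambda>a. \<i> *s frechet_derivative (\<lambda>z. H z b e) (at y) a)) (at y)"
      by (rule has_derivative_transform_within_open[OF bounded_linear.has_derivative[OF
            bounded_linear_vector_smult differentiable_has_frechet[OF H_diff[OF y]]] open_S y])
        (simp add: H_J)
    from frechet_derivative_eqI[OF this] show ?thesis by simp
  qed
  then show ?thesis
    by (simp add: chart_curvature_def H_J[OF y] vec_eq_iff algebra_simps)
qed

text \<open>The hypothesis presents the Chern numerator with u and Ju exchanged. Since the Chern
  curvature commutes with J and is skew in its first two arguments, the exchange does not change the
  value, and \<open>holomorphic_curvature_difference\<close> applies.\<close>

lemma contorsion_self_zero:
  assumes y: "y \<in> S"
    and eq: "g y (chart_curvature G y (\<i> *s u) u u) (\<i> *s u) =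
      g y (chart_curvature H y u (\<i> *s u) (\<i> *s u)) u"
  shows "contorsion y u u = 0"
proof -
  have swap: "chart_curvature H y u (\<i> *s u) u = - chart_curvature H y (\<i> *s u) u u"
    by (simp add: chart_curvature_def)
  have "g y (chart_curvature H y u (\<i> *s u) (\<i> *s u)) u = g y (chart_curvature H y (\<i> *s u) u u) (\<i> *s u)"
    by (simp add: H_curvature_J[OF y] g_J_skew[OF y] swap g_simps[OF y])
  then show ?thesis
    using holomorphic_curvature_difference[OF y, of u] eq g_pos[OF y, of "contorsion y u u"] by fastforce
qed

text \<open>If \<open>g(T(w, u), u) = 0\<close> for all \<open>w\<close>, \<open>u\<close>, then \<open>g(T(w, u), x)\<close> is alternating in \<open>u\<close>, \<open>x\<close>.
  Moving \<open>\<i>\<close> around the three arguments then shows that it equals its own negative.\<close>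

lemma torsion_zero:
  assumes y: "y \<in> S" and zero: "\<And>u. contorsion y u u = 0"
  shows "torsion y w u = 0"
proof -
  have quad: "g y (torsion y w u) u = 0" for w u
    using contorsion_self[OF y, of u w] by (simp add: zero g_simps[OF y])
  have add: "torsion y w (u + x) = torsion y w u + torsion y w x" for w u x
    by (simp add: torsion_def linear_add[OF H_linear[OF y]] linear_add[OF H_linear_left[OF y]])
  have alt: "g y (torsion y w u) x = - g y (torsion y w x) u" for w u x
    using quad[of w "u + x"] quad[of w u] quad[of w x] by (simp add: add g_simps[OF y])
  have "g y (\<i> *s torsion y w u) x = 0" for x
  proof -
    have "g y (\<i> *s torsion y w u) x = - g y (torsion y w x) (\<i> *s u)"
      using alt[of w "\<i> *s u" x] by (simp add: torsion_J[OF y])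
    also have "\<dots> = g y (torsion y (\<i> *s w) x) u"
      by (simp add: g_J_skew[OF y] torsion_J[OF y])
    also have "\<dots> = - g y (\<i> *s torsion y w u) x"
      using alt[of "\<i> *s w" x u] by (simp add: torsion_J[OF y])
    finally show ?thesis by simp
  qed
  then have "\<i> *s torsion y w u = 0"
    by (intro g_eqI[OF y]) (simp add: g_simps[OF y])
  then show ?thesis by (simp add: vec_eq_iff)
qed

text \<open>Each derivative expands by \<open>H_metric\<close> into two terms. With symmetric
  \<open>H\<close> and skew J the six terms cancel in pairs.\<close>

lemma kaehler_identity:
  assumes y: "y \<in> S" and sym: "\<And>a b. torsion y a b = 0"
  shows "frechet_derivative (\<lambda>y. g y (\<i> *s b) e) (at y) a - frechet_derivative (\<lambda>y. g y (\<i> *s a) e) (at y) b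
    + frechet_derivative (\<lambda>y. g y (\<i> *s a) b) (at y) e = 0"
proof -
  have s: "H y a b = H y b a" for a b using sym[of a b] by (simp add: torsion_def)
  show ?thesis
    using s[of a b] s[of a e] s[of b e] g_sym[OF y, of b]
    by (simp add: H_metric[OF y] H_J[OF y] g_J_skew[OF y] g_simps[OF y])
qed

end

section \<open>The fundamental form in a chart\<close>

lemma herm_form_smult:
  "herm_form H (z *s a) b = z * herm_form H a b" "herm_form H a (z *s b) = cnj z * herm_form H a b"
  by (simp_all add: herm_form_def sum_distrib_left mult_ac)

lemma herm_form_cnj:
  assumes "\<And>\<alpha> \<beta>. H $ \<beta> $ \<alpha> = cnj (H $ \<alpha> $ \<beta>)"
  shows "herm_form H b a = cnj (herm_form H a b)"
proof -
  have "H $ \<alpha> $ \<beta> * b $ \<alpha> * cnj (a $ \<beta>) = cnj (H $ \<beta> $ \<alpha> * a $ \<beta> * cnj (b $ \<alpha>))" for \<alpha> \<beta>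
    by (subst assms) simp
  then show ?thesis
    unfolding herm_form_def cnj_sum by (subst sum.swap) (simp only:)
qed

lemma linear_Re_herm_form: "linear (\<lambda>a. Re (herm_form H a b))"
  by (rule linearI) (simp_all add: herm_form_def algebra_simps sum.distrib sum_distrib_left)

context cmanifold
begin

lemma herm_form_cnj_metric:
  assumes "hermitian_metric A h" "c \<in> A" "p \<in> fst c"
  shows "herm_form (h c p) b a = cnj (herm_form (h c p) a b)"
  by (rule herm_form_cnj) (use assms in \<open>unfold hermitian_metric_def, blast\<close>)

text \<open>The form is \<i> (h(a, b) - cnj h(a, b)) = -2 Im h(a, b), and - Im h(a, b) = Re h(Ja,
  b).\<close>

lemma fundamental_form_eq:
  assumes "hermitian_metric A h" "c \<in> A" "y \<in> snd c ` fst c"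
  shows "fundamental_form h c y a b = of_real (2 * chart_metric h c y (\<i> *s a) b)"
proof -
  let ?H = "herm_form (h c (chart_inv c y))"
  have "fundamental_form h c y a b = \<i> * (?H a b - ?H b a)"
    by (simp add: fundamental_form_def herm_form_def sum_subtractf right_diff_distrib mult_ac)
  also have "?H b a = cnj (?H a b)"
    using assms by (intro herm_form_cnj_metric) auto
  finally show ?thesis
    by (simp add: chart_metric_def herm_form_smult complex_eq_iff)
qed

lemma ext_deriv2_fundamental_form:
  assumes "hermitian_metric A h" "c \<in> A" "y \<in> snd c ` fst c"
  shows "ext_deriv2 (fundamental_form h c) y a b e = of_real (2 *
    (frechet_derivative (\<lambda>y. chart_metric h c y (\<i> *s b) e) (at y) a
     - frechet_derivative (\<lambda>y. chart_metric h c y (\<i> *s a) e) (at y) b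
     + frechet_derivative (\<lambda>y. chart_metric h c y (\<i> *s a) b) (at y) e))"
proof -
  have "((\<lambda>y. fundamental_form h c y a b) has_derivative
     (\<lambda>v. of_real (2 * frechet_derivative (\<lambda>y. chart_metric h c y (\<i> *s a) b) (at y) v))) (at y)" for a b
    by (rule has_derivative_transform_within_open[OF _ chart_image_open[OF assms(2)] assms(3)],
        rule bounded_linear.has_derivative[OF bounded_linear_of_real],
        rule bounded_linear.has_derivative[OF bounded_linear_mult_right],
        rule differentiable_has_frechet[OF chart_metric_differentiable[OF assms]])
      (simp add: fundamental_form_eq[OF assms(1,2)])
  from frechet_derivative_eqI[OF this] show ?thesis
    by (simp add: ext_deriv2_def algebra_simps)
qed

end

theorem corollary1p2:
  fixes M :: "'a topology" and A :: "('a, 'n::finite) chart set" and h :: "('a, 'n) metric_coeffs"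
    and nabla :: "('a \<Rightarrow> ('a, 'n) tvec) \<Rightarrow> ('a \<Rightarrow> ('a, 'n) tvec) \<Rightarrow> 'a \<Rightarrow> ('a, 'n) tvec"
    and D :: "('a \<Rightarrow> ('a, 'n) tvec) \<Rightarrow> ('a \<Rightarrow> ('a, 'n) cvec) \<Rightarrow> 'a \<Rightarrow> ('a, 'n) cvec"
  assumes "complex_manifold M A"
    and "hermitian_metric A h"
    and "levi_civita M A h nabla"
    and "chern_connection M A h D"
    and "\<forall>p\<in>topspace M. \<forall>u\<in>tangent_space A p. \<forall>v\<in>tangent_space A p.
           lin_indep2 u v \<longrightarrow> riemann_sectional M A h nabla p u v = chern_sectional M A h D p u v"
  shows "kaehler_metric A h"
proof -
  interpret LC: affine_manifold M A nabla
    by unfold_locales (use assms in \<open>auto simp: levi_civita_def\<close>)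
  have D: "connection10 M A D" using assms(4) by (simp add: chern_connection_def)
  define T where "T = transport_to_real A D"
  interpret Ch: affine_manifold M A T
    unfolding T_def by unfold_locales (rule LC.transport_affine[OF D])
  note h = assms(2)
  have torsion_free: "nabla X Y p - nabla Y X p = lie_bracket A X Y p"
    if "openin M W" "vector_field A W X" "vector_field A W Y" "p \<in> W" for W X Y p
    using assms(3)[unfolded levi_civita_def, THEN conjunct2, rule_format, of W, THEN conjunct1,
        rule_format, of X Y p] that by blast
  have LC_metric: "deriv_along A p (X p) (\<lambda>q. riem_g A h q (Y q) (Z q)) =
      riem_g A h p (nabla X Y p) (Z p) + riem_g A h p (Y p) (nabla X Z p)"
    if "openin M W" "vector_field A W X" "vector_field A W Y" "vector_field A W Z" "p \<in> W" for W X Y Z p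
    using assms(3)[unfolded levi_civita_def, THEN conjunct2, rule_format, of W, THEN conjunct2,
        rule_format, of X Y Z p] that by blast
  have Ch_metric: "deriv_along A p (X p) (\<lambda>q. herm10 A h q (s q) (t q)) =
      herm10 A h p (D X s p) (t p) + herm10 A h p (s p) (D X t p)"
    if "openin M W" "vector_field A W X" "section10 A W s" "section10 A W t" "p \<in> W" for W X s t p
    using assms(4)[unfolded chern_connection_def, THEN conjunct2, rule_format, of W, THEN conjunct1,
        rule_format, of X s t p] that by blast
  have Ch_dbar: "dz (D X s p + cscale \<i> (D (\<lambda>q. cJ (X q)) s p)) c =
      frechet_derivative (\<lambda>y. dz (s (chart_inv c y)) c) (at (snd c p)) (X p c) +
      \<i> *s frechet_derivative (\<lambda>y. dz (s (chart_inv c y)) c) (at (snd c p)) (cJ (X p) c)"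
    if "openin M W" "vector_field A W X" "section10 A W s" "c \<in> A" "p \<in> W \<inter> fst c" for W X s c p
    using assms(4)[unfolded chern_connection_def, THEN conjunct2, rule_format, of W, THEN conjunct2,
        rule_format, of X s c p] that by blast
  \<comment> \<open>Torsion-freeness writes the bracket as a difference of covariant derivatives,
    which are smooth fields by the axioms of a connection.\<close>
  have bracket: "vector_field A W (lie_bracket A X Y)"
    if W: "openin M W" and X: "vector_field A W X" and Y: "vector_field A W Y" for W X Y
  proof (rule LC.vector_field_cong[OF W])
    show "vector_field A W (nabla X Y - nabla Y X)"
      using X Y by (intro LC.vector_field_diff LC.nabla_vector_field W)
    show "(nabla X Y - nabla Y X) p = lie_bracket A X Y p" if "p \<in> W" for p
      using torsion_free[OF W X Y that] by simp
  qed
  have "ext_deriv2 (fundamental_form h c) y a b e = 0" if c: "c \<in> A" and y: "y \<in> snd c ` fst c" for c y a b e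
  proof -
    let ?E = "LC.coord_field c"
    note W = LC.chart_openin[OF c]
    note E = LC.coord_field_vector_field[OF c]
    note ET = LC.coord_field_tangent[OF c]
    have inv: "chart_inv c y \<in> fst c" "snd c (chart_inv c y) = y" if "y \<in> snd c ` fst c" for y
      using that c by auto
    \<comment> \<open>The symbols are covariant derivatives of coordinate fields, so the metric and
      torsion conditions come from the global axioms evaluated on such fields over the whole chart
      domain.\<close>
    interpret hermitian_chart "snd c ` fst c" "LC.chart_metric h c" "LC.christoffel c" "Ch.christoffel c"
    proof (rule hermitian_chart.intro)
      fix y a b e assume y: "y \<in> snd c ` fst c"
      define p where "p = chart_inv c y"
      have p: "p \<in> fst c" "snd c p = y" "chart_inv c y = p" using inv[OF y] by (auto simp: p_def)
      note h_pos = h[unfolded hermitian_metric_def, THEN conjunct2, THEN conjunct1, rule_format, OF c p(1),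
          THEN conjunct2, rule_format]
      note tan = ET[OF p(1)] LC.vector_field_tangent[OF LC.nabla_vector_field[OF W E E] p(1)]
        LC.vector_field_tangent[OF Ch.nabla_vector_field[OF W E E] p(1)]
      show "linear (\<lambda>a. LC.chart_metric h c y a b)"
        unfolding LC.chart_metric_def by (rule linear_Re_herm_form)
      show "LC.chart_metric h c y a b = LC.chart_metric h c y b a"
        using LC.herm_form_cnj_metric[OF h c p(1), of a b] by (simp add: LC.chart_metric_def p)
      show "a \<noteq> 0 \<Longrightarrow> 0 < LC.chart_metric h c y a a"
        using h_pos[of a] by (simp add: LC.chart_metric_def p)
      show "LC.chart_metric h c y (\<i> *s a) (\<i> *s b) = LC.chart_metric h c y a b"
        by (simp add: LC.chart_metric_def herm_form_smult)
      show "(\<lambda>y. LC.chart_metric h c y a b) differentiable at y"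
        by (rule LC.chart_metric_differentiable[OF h c y])
      show "linear (LC.christoffel c y a)" "linear (Ch.christoffel c y a)"
        "(\<lambda>y. LC.christoffel c y a b) differentiable at y" "(\<lambda>y. Ch.christoffel c y a b) differentiable at y"
        "linear (\<lambda>a. Ch.christoffel c y a b)"
        by (intro LC.christoffel_linear_right Ch.christoffel_linear_right LC.christoffel_differentiable
            Ch.christoffel_differentiable Ch.christoffel_linear_left c y)+
      show "LC.christoffel c y a b = LC.christoffel c y b a"
      proof -
        have "lie_bracket A (?E a) (?E b) p c = 0"
          using c p LC.coord_field_derivative[OF c p(1)] by (simp add: lie_bracket_def)
        then have "(nabla (?E a) (?E b) p - nabla (?E b) (?E a) p) c = 0"
          using torsion_free[OF W E E p(1)] by metis
        then show ?thesis by (simp add: LC.christoffel_def p)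
      qed
      have d: "frechet_derivative (\<lambda>y. LC.chart_metric h c y b e) (at y) a =
        deriv_along A p (?E a p) (\<lambda>q. riem_g A h q (?E b q) (?E e q))"
        using LC.deriv_along_riem_g(1)[OF h c p(1) ET[OF p(1)], of a b e]
        by (simp add: LC.coord_field_self c p)
      show "frechet_derivative (\<lambda>y. LC.chart_metric h c y b e) (at y) a =
        LC.chart_metric h c y (LC.christoffel c y a b) e + LC.chart_metric h c y b (LC.christoffel c y a e)"
        unfolding d LC_metric[OF W E E E p(1)]
        by (simp add: LC.riem_g_eq[OF h c p(1)] tan p LC.christoffel_def LC.coord_field_self c)
      have s: "section10 A (fst c) (\<lambda>q. to10 (?E b q))" for b
        by (rule LC.section10_to10[OF W E])
      have T_dz: "T (?E a) (?E b) p = dz (D (?E a) (\<lambda>q. to10 (?E b q)) p)" for a b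
        unfolding T_def by (rule LC.transport_dz[OF D W E E p(1)])
      have "deriv_along A p (?E a p) (\<lambda>q. herm A h q (?E b q) (?E e q)) =
        herm A h p (T (?E a) (?E b) p) (?E e p) + herm A h p (?E b p) (T (?E a) (?E e) p)"
        using Ch_metric[OF W E s s p(1)] by (simp add: herm10_def dz_to10 T_dz)
      then have "deriv_along A p (?E a p) (\<lambda>q. riem_g A h q (?E b q) (?E e q)) =
        riem_g A h p (T (?E a) (?E b) p) (?E e p) + riem_g A h p (?E b p) (T (?E a) (?E e) p)"
        unfolding LC.deriv_along_riem_g(2)[OF h c p(1) ET[OF p(1)]] by (simp add: riem_g_def)
      then show "frechet_derivative (\<lambda>y. LC.chart_metric h c y b e) (at y) a =
        LC.chart_metric h c y (Ch.christoffel c y a b) e + LC.chart_metric h c y b (Ch.christoffel c y a e)"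
        unfolding d
        by (simp add: LC.riem_g_eq[OF h c p(1)] tan p Ch.christoffel_def LC.coord_field_self c)
      show "Ch.christoffel c y a (\<i> *s b) = \<i> *s Ch.christoffel c y a b"
        using LC.transport_tscale[OF D W E E p(1), of a \<i> b, folded T_def]
        by (simp add: Ch.christoffel_def p LC.coord_field_smult tscale_apply)
      \<comment> \<open>Coordinate fields have constant coefficients in the holomorphic frame, so
        their d-bar derivative is 0. Multiplying by \<i> then gives complex linearity in the
        direction of differentiation.\<close>
      have "T (?E a) (?E b) p c + \<i> *s T (?E (\<i> *s a)) (?E b) p c = 0"
        using Ch_dbar[OF W E s c, of p a b] p(1) LC.coord_field_derivative[OF c p(1)]
        unfolding T_dz by (simp add: dz_add dz_cscale dz_to10 tscale_apply cJ_def LC.coord_field_smult)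
      then have "\<i> *s (T (?E a) (?E b) p c + \<i> *s T (?E (\<i> *s a)) (?E b) p c) = 0"
        by simp
      then show "Ch.christoffel c y (\<i> *s a) b = \<i> *s Ch.christoffel c y a b"
        by (simp add: Ch.christoffel_def p vec_eq_iff algebra_simps)
    qed (rule LC.chart_image_open[OF c])
    define p where "p = chart_inv c y"
    have p: "p \<in> fst c" "snd c p = y" "p \<in> topspace M"
      using inv[OF y] LC.chart_subset[OF c] by (auto simp: p_def)
    have "contorsion y w w = 0" for w
    \<comment> \<open>For \<open>w\<close> = 0 there is no plane, and linearity gives the
      claim.\<close>
    proof (cases "w = 0")
      case True
      then show ?thesis
        using linear_0[OF LC.christoffel_linear_right[OF c y]] linear_0[OF Ch.christoffel_linear_right[OF c y]]
        by (simp add: contorsion_def)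
    next
      case False
      \<comment> \<open>Jw comes first, so that the two sectional curvatures have exactly the
        numerators of \<open>contorsion_self_zero\<close>.\<close>
      let ?u = "?E (\<i> *s w) p" and ?v = "?E w p"
      note T = ET[OF p(1), of "\<i> *s w"] ET[OF p(1), of w]
      have comp: "?u c = \<i> *s w" "?v c = w" by (simp_all add: LC.coord_field_self c p)
      have "lin_indep2 ?u ?v"
        unfolding lin_indep2_def
      proof (intro allI impI)
        fix a b :: real
        assume 0: "tscale (of_real a) ?u + tscale (of_real b) ?v = 0"
        have "of_real a *s (\<i> *s w) + of_real b *s w = 0"
          using fun_cong[OF 0, of c] by (simp add: tscale_apply comp)
        moreover obtain i where i: "w $ i \<noteq> 0" using False by (auto simp: vec_eq_iff)
        ultimately have "(of_real a * \<i> + of_real b) * w $ i = 0"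
          by (simp add: vec_eq_iff algebra_simps)
        then have "of_real a * \<i> + of_real b = (0 :: complex)" using i unfolding mult_eq_0_iff by blast
        then show "a = 0 \<and> b = 0" by (simp add: complex_eq_iff)
      qed
      then have "riemann_sectional M A h nabla p ?u ?v = chern_sectional M A h D p ?u ?v"
        using assms(5) p(3) T by blast
      \<comment> \<open>w and Jw are orthogonal of equal length; the common denominator is nonzero
        and can be cancelled.\<close>
      moreover have "area2 A h p ?u ?v = (LC.chart_metric h c y w w)\<^sup>2"
        using g_J_skew[OF y, of w w] g_sym[OF y, of "\<i> *s w" w]
        by (simp add: area2_def LC.riem_g_eq[OF h c p(1)] T comp p g_J[OF y] power2_eq_square)
      moreover have "LC.chart_metric h c y w w \<noteq> 0" using g_pos[OF y False] by simp
      ultimately have "riem_g A h p (curvature_at M A nabla p ?u ?v ?v) ?u =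
          riem_g A h p (curvature_at M A T p ?v ?u ?u) ?v"
        by (simp add: riemann_sectional_def chern_sectional_def T_def)
      then show ?thesis
        using contorsion_self_zero[OF y, of w] LC.curvature_at[OF bracket c p(1)]
          Ch.curvature_at[OF bracket c p(1)] T
        by (simp add: LC.riem_g_eq[OF h c p(1)] comp p)
    qed
    then show ?thesis
      using kaehler_identity[OF y torsion_zero[OF y]] LC.ext_deriv2_fundamental_form[OF h c y] by simp
  qed
  then show ?thesis using h by (simp add: kaehler_metric_def)
qed

end
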